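(* Let $\beta\in\mathbb C$ with $\beta^4=-1$. The Hopf algebra $Q=\overline{U}_{\mathrm i}s\ell(2)$ becomes a quasi-triangular quasi-Hopf algebra (with the same algebra structure, coproduct, counit and antipode $S$) when equipped with the coassociator $\Phi$, the R-matrix $R$, the evaluation element $\boldsymbol\alpha$ and the coevaluation element $\boldsymbol\beta$ given explicitly in the context.
   Context: **The algebra.** $Q=\overline{U}_{\mathrm i}s\ell(2)$ is the associative unital $\mathbb C$-algebra with generators $E,F,K^{\pm1}$ and relations $KEK^{-1}=-E$, $KFK^{-1}=-F$, $[E,F]=\frac{K-K^{-1}}{2\mathrm i}$, $E^2=F^2=0$, $K^4=1$ (dimension 16). It is a Hopf algebra with $\Delta(E)=1\otimes E+E\otimes K$, $\Delta(F)=K^{-1}\otimes F+F\otimes 1$, $\Delta(K)=K\otimes K$, $\epsilon(E)=\epsilon(F)=0$, $\epsilon(K)=1$, $S(E)=-EK^{-1}$, $S(F)=-KF$, $S(K)=K^{-1}$. Central idempotents: $e_0=\frac12(1+K^2)$, $e_1=\frac12(1-K^2)$. **Coassociator.** $$\Phi=e_0\otimes e_0\otimes e_0+e_1\otimes e_0\otimes e_0+\Phi^{010}\,e_0\otimes e_1\otimes e_0+e_0\otimes e_0\otimes e_1+e_1\otimes e_1\otimes e_0+\Phi^{101}\,e_1\otimes e_0\otimes e_1+e_0\otimes e_1\otimes e_1+\Phi^{111}\,e_1\otimes e_1\otimes e_1,$$ with $\Phi^{010}=1\otimes1\otimes1-(1+\mathrm i)E\otimes K\otimes F+(1-\mathrm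 i)FK\otimes K\otimes EK+2\,EFK\otimes1\otimes EFK$; $\Phi^{101}=(\mathrm i-1)1\otimes F\otimes EK+1\otimes K\otimes1+2\cdot1\otimes EF\otimes EFK-(1+\mathrm i)1\otimes EK\otimes F-(1+\mathrm i)E\otimes FK\otimes1+2\mathrm i\,E\otimes EFK\otimes F+(1-\mathrm i)FK\otimes E\otimes1-2\mathrm i\,FK\otimes EFK\otimes EK-2\,EFK\otimes EF\otimes1$; $\Phi^{111}=\mathrm i\beta^2\{(1+\mathrm i)1\otimes F\otimes EK-1\otimes K\otimes1-2\cdot1\otimes EF\otimes1-2\mathrm i\,1\otimes EF\otimes EFK+(1+\mathrm i)1\otimes EK\otimes F-(1+\mathrm i)E\otimes1\otimes F+(1+\mathrm i)E\otimes FK\otimes1+2\mathrm i\,E\otimes FK\otimes EFK+2\,E\otimes EFK\otimes F-(1+\mathrm i)FK\otimes1\otimes EK+(1+\mathrm i)FK\otimes E\otimes1+2\mathrm i\,FK\otimes E\otimes EFK+2\,FK\otimes EFK\otimes EK+2\mathrm i\,EFK\otimes F\otimes EK+2\mathrm i\,EFK\otimes K\otimes EFK-2\mathrm i\,EFK\otimes EF\otimes1+2\mathrm i\,EFK\otimes EK\otimes F+4\,EFK\otimes EF\otimes EFK\}$. **Evaluation/coevaluation elements.** $\boldsymbol\alpha=1$, $\boldsymbol\beta=e_0-2\mathrm i\beta^2\,C\,e_1$, where $C=FE-\frac{\mathrm i}{4}(K-K^{-1})$. **R-matrix.** $R=R^{00}e_0\otimes e_0+R^{01}e_0\otimes e_1+R^{10}e_1\otimes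 e_0+R^{11}e_1\otimes e_1$ with $R^{00}=\frac12(1\otimes1+1\otimes K+K\otimes1-K\otimes K)\{1\otimes1+2\mathrm i\,E\otimes F\}$, $R^{01}=\frac12(1\otimes1-\mathrm i\,1\otimes K+K\otimes1+\mathrm i\,K\otimes K)\{1\otimes1+(1-\mathrm i)FK\otimes EK-(1-\mathrm i)E\otimes F+(1+\mathrm i)EFK\otimes1+2\mathrm i\,EFK\otimes EFK\}$, $R^{10}=\frac12(1\otimes1+1\otimes K-\mathrm i\,K\otimes1+\mathrm i\,K\otimes K)\{1\otimes K+(1-\mathrm i)FK\otimes E+(1-\mathrm i)E\otimes FK-(1-\mathrm i)1\otimes EF-2\mathrm i\,EFK\otimes EF\}$, $R^{11}=\frac\beta2(1\otimes1-\mathrm i\,1\otimes K-\mathrm i\,K\otimes1+K\otimes K)\{-\mathrm i\,K\otimes1+2\mathrm i\,EK\otimes F+(1-\mathrm i)K\otimes EFK-(1+\mathrm i)EF\otimes1-2\mathrm i\,EF\otimes EFK\}$. **Definition of quasi-triangular quasi-Hopf algebra.** A quasi-bialgebra is a unital associative algebra $A$ with algebra homomorphisms $\epsilon:A\to\mathbb C$, $\Delta:A\to A\otimes A$ and an invertible $\Phi\in A^{\otimes3}$ such that $(\epsilon\otimes\mathrm{id})\Delta=\mathrm{id}=(\mathrm{id}\otimes\epsilon)\Delta$; $(\Delta\otimes\mathrm{id})(\Delta(a))=\Phi\,((\mathrm{id}\otimes\Delta)(\Delta(a)))\,\Phi^{-1}$ for all $a$; $(\mathrm{id}\otimes\epsilon\otimes\mathrm{id})(\Phi)=1\otimes1$;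 and $(\Delta\otimes\mathrm{id}\otimes\mathrm{id})(\Phi)\cdot(\mathrm{id}\otimes\mathrm{id}\otimes\Delta)(\Phi)=(\Phi\otimes1)\cdot(\mathrm{id}\otimes\Delta\otimes\mathrm{id})(\Phi)\cdot(1\otimes\Phi)$. It is quasi-triangular if equipped with an invertible $R\in A\otimes A$ with $R\Delta(a)=\Delta^{\mathrm{op}}(a)R$ for all $a$, $(\Delta\otimes\mathrm{id})(R)=\Phi_{231}^{-1}R_{13}\Phi_{132}R_{23}\Phi^{-1}$ and $(\mathrm{id}\otimes\Delta)(R)=\Phi_{312}R_{13}\Phi_{213}^{-1}R_{12}\Phi$, where for $\Phi=\sum\Phi'\otimes\Phi''\otimes\Phi'''$ one sets $\Phi_{231}=\sum\Phi''\otimes\Phi'''\otimes\Phi'$, etc. It is a (quasi-triangular) quasi-Hopf algebra if moreover equipped with an algebra anti-homomorphism $S:A\to A$ and elements $\boldsymbol\alpha,\boldsymbol\beta\in A$ with $\sum S(a')\boldsymbol\alpha a''=\epsilon(a)\boldsymbol\alpha$, $\sum a'\boldsymbol\beta S(a'')=\epsilon(a)\boldsymbol\beta$ for all $a$ (where $\Delta(a)=\sum a'\otimes a''$), $\sum S(\Phi')\boldsymbol\alpha\Phi''\boldsymbol\beta S(\Phi''')=1$ and $\sum(\Phi^{-1})'\boldsymbol\beta S((\Phi^{-1})'')\boldsymbol\alpha(\Phi^{-1})'''=1$. *)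

theory Defs
  imports Complex_Main "HOL-Library.Poly_Mapping"
begin

section \<open>Unital associative complex algebras\<close>

class complex_algebra = ring_1 +
  fixes scaleC :: "complex \<Rightarrow> 'a \<Rightarrow> 'a" (infixr \<open>*\<^sub>C\<close> 75)
  assumes scaleC_add_right: "c *\<^sub>C (x + y) = c *\<^sub>C x + c *\<^sub>C y"
    and scaleC_add_left: "(c + d) *\<^sub>C x = c *\<^sub>C x + d *\<^sub>C x"
    and scaleC_scaleC [simp]: "c *\<^sub>C (d *\<^sub>C x) = (c * d) *\<^sub>C x"
    and scaleC_one [simp]: "1 *\<^sub>C x = x"
    and mult_scaleC_left [simp]: "(c *\<^sub>C x) * y = c *\<^sub>C (x * y)"
    and mult_scaleC_right [simp]: "x * (c *\<^sub>C y) = c *\<^sub>C (x * y)"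

global_interpretation cvec: vector_space "scaleC :: complex \<Rightarrow> 'a \<Rightarrow> 'a::complex_algebra"
  by standard (simp_all add: scaleC_add_right scaleC_add_left)

abbreviation clinear :: "('a::complex_algebra \<Rightarrow> 'b::complex_algebra) \<Rightarrow> bool"
  where "clinear \<equiv> Vector_Spaces.linear scaleC scaleC"

lemma clinear_iff:
  "clinear f \<longleftrightarrow> (\<forall>x y. f (x + y) = f x + f y) \<and> (\<forall>c x. f (c *\<^sub>C x) = c *\<^sub>C f x)"
  by (simp add: Vector_Spaces.linear_def module_hom_def module_hom_axioms_def
      cvec.module_axioms cvec.vector_space_axioms)

lemma clinearI:
  "(\<And>x y. f (x + y) = f x + f y) \<Longrightarrow> (\<And>c x. f (c *\<^sub>C x) = c *\<^sub>C f x) \<Longrightarrow> clinear f"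
  by (simp add: clinear_iff)

lemma clinear_add: "clinear f \<Longrightarrow> f (x + y) = f x + f y"
  and clinear_scale: "clinear f \<Longrightarrow> f (c *\<^sub>C x) = c *\<^sub>C f x"
  by (simp_all add: clinear_iff)

lemma clinear_0: "clinear f \<Longrightarrow> f 0 = 0"
  using clinear_scale[of f 0 0] by simp

lemma clinear_uminus: "clinear f \<Longrightarrow> f (- x) = - f x"
  using clinear_scale[of f "-1" x] by simp

lemma clinear_diff: "clinear f \<Longrightarrow> f (x - y) = f x - f y"
  using clinear_add[of f x "- y"] clinear_uminus[of f y] by simp

definition cbilinear :: "('a::complex_algebra \<Rightarrow> 'b::complex_algebra \<Rightarrow> 'c::complex_algebra) \<Rightarrow> bool"
  where "cbilinear f \<longleftrightarrow> (\<forall>x. clinear (f x)) \<and> (\<forall>y. clinear (\<lambda>x. f x y))"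

definition algebra_hom :: "('a::complex_algebra \<Rightarrow> 'b::complex_algebra) \<Rightarrow> bool"
  where "algebra_hom f \<longleftrightarrow> clinear f \<and> f 1 = 1 \<and> (\<forall>x y. f (x * y) = f x * f y)"

definition algebra_antihom :: "('a::complex_algebra \<Rightarrow> 'b::complex_algebra) \<Rightarrow> bool"
  where "algebra_antihom f \<longleftrightarrow> clinear f \<and> f 1 = 1 \<and> (\<forall>x y. f (x * y) = f y * f x)"

definition has_inverse :: "'a::ring_1 \<Rightarrow> bool"
  where "has_inverse x \<longleftrightarrow> (\<exists>y. x * y = 1 \<and> y * x = 1)"

definition the_inverse :: "'a::ring_1 \<Rightarrow> 'a"
  where "the_inverse x = (THE y. x * y = 1 \<and> y * x = 1)"

lemma the_inverse_eq:
  assumes "x * y = 1" "y * x = 1"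
  shows "the_inverse x = y"
  unfolding the_inverse_def
proof (rule the_equality)
  fix z assume z: "x * z = 1 \<and> z * x = 1"
  have "z = z * (x * y)" using assms by simp
  also have "\<dots> = y" using z by (simp flip: mult.assoc)
  finally show "z = y" .
qed (use assms in simp)

instantiation complex :: complex_algebra
begin
definition scaleC_complex :: "complex \<Rightarrow> complex \<Rightarrow> complex" where "scaleC_complex = (*)"
instance by standard (simp_all add: scaleC_complex_def algebra_simps)
end

lemma poly_mapping_single_induct [case_names zero single add]:
  assumes "P 0" "\<And>k c. P (Poly_Mapping.single k c)" "\<And>p q. P p \<Longrightarrow> P q \<Longrightarrow> P (p + q)"
  shows "P p"
proof (induction p rule: update_induct)
  case const
  have "(0::'a \<Rightarrow>\<^sub>0 'b) = Poly_Mapping.single undefined 0" by simp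
  then show ?case using assms(1) by simp
next
  case (update f a b)
  have "Poly_Mapping.update a b f = f + Poly_Mapping.single a b"
    using update(1)
    by (intro poly_mapping_eqI) (auto simp: lookup_update lookup_add lookup_single when_def in_keys_iff)
  then show ?case using update(3) assms(2,3) by simp
qed

instantiation poly_mapping :: (monoid_add, complex_algebra) complex_algebra
begin
definition scaleC_poly_mapping :: "complex \<Rightarrow> ('a \<Rightarrow>\<^sub>0 'b) \<Rightarrow> ('a \<Rightarrow>\<^sub>0 'b)"
  where "scaleC_poly_mapping c p = Poly_Mapping.single 0 (c *\<^sub>C 1) * p"
instance
proof
  fix c d :: complex and x y :: "'a \<Rightarrow>\<^sub>0 'b"
  have comm: "Poly_Mapping.single 0 (c *\<^sub>C 1) * x = x * Poly_Mapping.single 0 (c *\<^sub>C 1)"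
    by (induction x rule: poly_mapping_single_induct)
      (simp_all add: mult_single distrib_left distrib_right)
  show "c *\<^sub>C (x + y) = c *\<^sub>C x + c *\<^sub>C y"
    by (simp add: scaleC_poly_mapping_def distrib_left)
  show "(c + d) *\<^sub>C x = c *\<^sub>C x + d *\<^sub>C x"
    by (simp add: scaleC_poly_mapping_def scaleC_add_left single_add distrib_right)
  show "c *\<^sub>C (d *\<^sub>C x) = (c * d) *\<^sub>C x"
    by (simp add: scaleC_poly_mapping_def mult_single mult.commute[of c] flip: mult.assoc)
  show "1 *\<^sub>C x = x" by (simp add: scaleC_poly_mapping_def)
  show "(c *\<^sub>C x) * y = c *\<^sub>C (x * y)" by (simp add: scaleC_poly_mapping_def mult.assoc)
  show "x * (c *\<^sub>C y) = c *\<^sub>C (x * y)"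
    unfolding scaleC_poly_mapping_def using comm by (simp flip: mult.assoc)
qed
end

lemma scaleC_single: "c *\<^sub>C Poly_Mapping.single k d = Poly_Mapping.single k (c *\<^sub>C d)"
  by (simp add: scaleC_poly_mapping_def mult_single)

text \<open>Finitely supported functions on a monoid (written additively, as \<open>Poly_Mapping\<close> requires)
  form the monoid algebra; a map out of the monoid extends linearly.\<close>

definition lin_ext :: "('m \<Rightarrow> 'v) \<Rightarrow> ('m \<Rightarrow>\<^sub>0 complex) \<Rightarrow> 'v::complex_algebra"
  where "lin_ext f p = (\<Sum>m\<in>Poly_Mapping.keys p. Poly_Mapping.lookup p m *\<^sub>C f m)"

lemma lin_ext_superset:
  assumes "finite A" "Poly_Mapping.keys p \<subseteq> A"
  shows "lin_ext f p = (\<Sum>m\<in>A. Poly_Mapping.lookup p m *\<^sub>C f m)"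
  unfolding lin_ext_def using assms by (intro sum.mono_neutral_left) (auto simp: in_keys_iff)

lemma lin_ext_0 [simp]: "lin_ext f 0 = 0"
  by (simp add: lin_ext_def)

lemma lin_ext_single [simp]: "lin_ext f (Poly_Mapping.single m c) = c *\<^sub>C f m"
  by (subst lin_ext_superset[of "{m}"]) simp_all

lemma lin_ext_1: "lin_ext f 1 = f 0"
  using lin_ext_single[of f 0 1] by simp

lemma lin_ext_add: "lin_ext f (p + q) = lin_ext f p + lin_ext f q"
proof -
  let ?A = "Poly_Mapping.keys p \<union> Poly_Mapping.keys q"
  have "finite ?A" "Poly_Mapping.keys (p + q) \<subseteq> ?A"
    using Poly_Mapping.keys_add[of p q] by auto
  then show ?thesis
    by (simp add: lin_ext_superset[of ?A] lookup_add scaleC_add_left sum.distrib)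
qed

lemma lin_ext_scale: "lin_ext f (c *\<^sub>C p) = c *\<^sub>C lin_ext f (p :: 'm::monoid_add \<Rightarrow>\<^sub>0 complex)"
  by (induction p rule: poly_mapping_single_induct)
    (simp_all add: scaleC_single lin_ext_add scaleC_add_right scaleC_complex_def)

lemma clinear_lin_ext: "clinear (lin_ext f :: ('m::monoid_add \<Rightarrow>\<^sub>0 complex) \<Rightarrow> _)"
  by (simp add: clinear_iff lin_ext_add lin_ext_scale)

lemma algebra_hom_lin_ext:
  assumes "f 0 = 1" "\<And>m n. f (m + n) = f m * f n"
  shows "algebra_hom (lin_ext f)"
proof -
  have "lin_ext f (p * q) = lin_ext f p * lin_ext f q" for p q
  proof (induction p rule: poly_mapping_single_induct)
    case (single k c)
    show ?case
      by (induction q rule: poly_mapping_single_induct)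
        (simp_all add: mult_single distrib_left lin_ext_add assms)
  qed (simp_all add: distrib_right lin_ext_add)
  then show ?thesis
    using assms(1) by (simp add: lin_ext_1 algebra_hom_def clinear_lin_ext)
qed

lemma algebra_antihom_lin_ext:
  assumes "f 0 = 1" "\<And>m n. f (m + n) = f n * f m"
  shows "algebra_antihom (lin_ext f)"
proof -
  have "lin_ext f (p * q) = lin_ext f q * lin_ext f p" for p q
  proof (induction p rule: poly_mapping_single_induct)
    case (single k c)
    show ?case
      by (induction q rule: poly_mapping_single_induct)
        (simp_all add: mult_single distrib_left distrib_right lin_ext_add scaleC_add_right assms mult.commute[of c])
  qed (simp_all add: distrib_left distrib_right lin_ext_add)
  then show ?thesis
    using assms(1) by (simp add: lin_ext_1 algebra_antihom_def clinear_lin_ext)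
qed

section \<open>Tensor products of algebras\<close>

datatype ('a, 'b) tpair = TPair 'a 'b

text \<open>The additive notation below only serves to make \<open>\<Rightarrow>\<^sub>0\<close> provide the convolution product:
  the monoid operation on \<open>A \<times> B\<close> is the componentwise multiplication.\<close>

instantiation tpair :: (monoid_mult, monoid_mult) monoid_add
begin
definition zero_tpair :: "('a, 'b) tpair" where "0 = TPair 1 1"
fun plus_tpair :: "('a, 'b) tpair \<Rightarrow> ('a, 'b) tpair \<Rightarrow> ('a, 'b) tpair"
  where "TPair a b + TPair a' b' = TPair (a * a') (b * b')"
instance
proof
  fix x y z :: "('a, 'b) tpair"
  show "x + y + z = x + (y + z)" by (cases x; cases y; cases z) (simp add: mult.assoc)
  show "0 + x = x" "x + 0 = x" by (cases x; simp add: zero_tpair_def)+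
qed
end

abbreviation free_pure :: "'a \<Rightarrow> 'b \<Rightarrow> ('a, 'b) tpair \<Rightarrow>\<^sub>0 complex"
  where "free_pure a b \<equiv> Poly_Mapping.single (TPair a b) 1"

definition bilinear_relators :: "(('a::complex_algebra, 'b::complex_algebra) tpair \<Rightarrow>\<^sub>0 complex) set"
  where "bilinear_relators =
      {free_pure (a + a') b - free_pure a b - free_pure a' b | a a' b. True}
    \<union> {free_pure a (b + b') - free_pure a b - free_pure a b' | a b b'. True}
    \<union> {free_pure (c *\<^sub>C a) b - c *\<^sub>C free_pure a b | c a b. True}
    \<union> {free_pure a (c *\<^sub>C b) - c *\<^sub>C free_pure a b | c a b. True}"

lemma bilinear_relators:
  "free_pure (a + a') b - free_pure a b - free_pure a' b \<in> bilinear_relators"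
  "free_pure a (b + b') - free_pure a b - free_pure a b' \<in> bilinear_relators"
  "free_pure (c *\<^sub>C a) b - c *\<^sub>C free_pure a b \<in> bilinear_relators"
  "free_pure a (c *\<^sub>C b) - c *\<^sub>C free_pure a b \<in> bilinear_relators"
  unfolding bilinear_relators_def by blast+

abbreviation bilinear_span :: "(('a::complex_algebra, 'b::complex_algebra) tpair \<Rightarrow>\<^sub>0 complex) set"
  where "bilinear_span \<equiv> cvec.span bilinear_relators"

lemma bilinear_span_ideal:
  assumes "p \<in> bilinear_span"
  shows "q * p \<in> bilinear_span" "p * q \<in> bilinear_span"
proof -
  have rel_left: "Poly_Mapping.single m c * r \<in> bilinear_span"
    and rel_right: "r * Poly_Mapping.single m c \<in> bilinear_span"
    if r: "r \<in> bilinear_relators" for m c and r :: "('a, 'b) tpair \<Rightarrow>\<^sub>0 complex"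
  proof -
    obtain x y where m: "m = TPair x y" by (cases m)
    have c: "Poly_Mapping.single m c = c *\<^sub>C free_pure x y"
      by (simp add: m scaleC_single scaleC_complex_def)
    have "free_pure x y * r \<in> bilinear_relators \<and> r * free_pure x y \<in> bilinear_relators"
      using r[unfolded bilinear_relators_def]
    proof (elim UnE)
      assume "r \<in> {free_pure (a + a') b - free_pure a b - free_pure a' b | a a' b. True}"
      then obtain a a' b where "r = free_pure (a + a') b - free_pure a b - free_pure a' b" by blast
      then have
        "free_pure x y * r = free_pure (x * a + x * a') (y * b) - free_pure (x * a) (y * b) - free_pure (x * a') (y * b)"
        "r * free_pure x y = free_pure (a * x + a' * x) (b * y) - free_pure (a * x) (b * y) - free_pure (a' * x) (b * y)"
        by (simp_all add: mult_single right_diff_distrib left_diff_distrib distrib_left distrib_right)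
      then show ?thesis by (simp add: bilinear_relators)
    next
      assume "r \<in> {free_pure a (b + b') - free_pure a b - free_pure a b' | a b b'. True}"
      then obtain a b b' where "r = free_pure a (b + b') - free_pure a b - free_pure a b'" by blast
      then have
        "free_pure x y * r = free_pure (x * a) (y * b + y * b') - free_pure (x * a) (y * b) - free_pure (x * a) (y * b')"
        "r * free_pure x y = free_pure (a * x) (b * y + b' * y) - free_pure (a * x) (b * y) - free_pure (a * x) (b' * y)"
        by (simp_all add: mult_single right_diff_distrib left_diff_distrib distrib_left distrib_right)
      then show ?thesis by (simp add: bilinear_relators)
    next
      assume "r \<in> {free_pure (c *\<^sub>C a) b - c *\<^sub>C free_pure a b | c a b. True}"
      then obtain c a b where "r = free_pure (c *\<^sub>C a) b - c *\<^sub>C free_pure a b" by blast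
      then have
        "free_pure x y * r = free_pure (c *\<^sub>C (x * a)) (y * b) - c *\<^sub>C free_pure (x * a) (y * b)"
        "r * free_pure x y = free_pure (c *\<^sub>C (a * x)) (b * y) - c *\<^sub>C free_pure (a * x) (b * y)"
        by (simp_all add: mult_single right_diff_distrib left_diff_distrib)
      then show ?thesis by (simp add: bilinear_relators)
    next
      assume "r \<in> {free_pure a (c *\<^sub>C b) - c *\<^sub>C free_pure a b | c a b. True}"
      then obtain c a b where "r = free_pure a (c *\<^sub>C b) - c *\<^sub>C free_pure a b" by blast
      then have
        "free_pure x y * r = free_pure (x * a) (c *\<^sub>C (y * b)) - c *\<^sub>C free_pure (x * a) (y * b)"
        "r * free_pure x y = free_pure (a * x) (c *\<^sub>C (b * y)) - c *\<^sub>C free_pure (a * x) (b * y)"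
        by (simp_all add: mult_single right_diff_distrib left_diff_distrib)
      then show ?thesis by (simp add: bilinear_relators)
    qed
    then show "Poly_Mapping.single m c * r \<in> bilinear_span"
      "r * Poly_Mapping.single m c \<in> bilinear_span"
      unfolding c by (simp_all add: cvec.span_scale cvec.span_base)
  qed
  have rel: "q * r \<in> bilinear_span \<and> r * q \<in> bilinear_span" if "r \<in> bilinear_relators" for r
    by (induction q rule: poly_mapping_single_induct)
      (use that rel_left rel_right in
        \<open>auto simp: distrib_left distrib_right cvec.span_zero intro: cvec.span_add\<close>)
  have "q * p \<in> bilinear_span \<and> p * q \<in> bilinear_span"
    using assms
  proof (induction p rule: cvec.span_induct_alt)
    case base
    then show ?case by (simp add: cvec.span_zero)
  next
    case (step c x y)
    then show ?case
      using rel[of x] by (simp add: distrib_left distrib_right cvec.span_add cvec.span_scale)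
  qed
  then show "q * p \<in> bilinear_span" "p * q \<in> bilinear_span" by auto
qed

text \<open>The tensor product of the underlying vector spaces; the span is an ideal of the monoid algebra
  of \<open>A \<times> B\<close>, so the quotient inherits the product \<open>(a \<otimes> b)(a' \<otimes> b') = aa' \<otimes> bb'\<close>.\<close>

quotient_type (overloaded) ('a, 'b) tensor =
    "('a::complex_algebra, 'b::complex_algebra) tpair \<Rightarrow>\<^sub>0 complex" /
    "\<lambda>p q. p - q \<in> bilinear_span"
proof (rule equivpI)
  show "reflp (\<lambda>p q. p - q \<in> bilinear_span)" by (simp add: reflp_def cvec.span_zero)
  show "symp (\<lambda>p q. p - q \<in> bilinear_span)"
    unfolding symp_def using cvec.span_neg by fastforce
  show "transp (\<lambda>p q. p - q \<in> bilinear_span)"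
    unfolding transp_def using cvec.span_add by fastforce
qed

lemma lin_ext_bilinear_span:
  assumes f: "cbilinear f" and p: "p \<in> bilinear_span"
  shows "lin_ext (case_tpair f) p = 0"
  using p
proof (induction p rule: cvec.span_induct_alt)
  case (step c x y)
  have add: "f (a + a') b = f a b + f a' b" "f a (b + b') = f a b + f a b'"
    and scale: "f (c *\<^sub>C a) b = c *\<^sub>C f a b" "f a (c *\<^sub>C b) = c *\<^sub>C f a b" for a a' b b' c
    using f by (simp_all add: cbilinear_def clinear_iff)
  have diff: "lin_ext (case_tpair f) (p - q) = lin_ext (case_tpair f) p - lin_ext (case_tpair f) q" for p q
    by (rule clinear_diff[OF clinear_lin_ext])
  have "lin_ext (case_tpair f) x = 0"
    using step(1) unfolding bilinear_relators_def
    by (elim UnE CollectE exE) (simp_all add: diff lin_ext_scale add scale)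
  then show ?case using step(2) by (simp add: lin_ext_add lin_ext_scale)
qed simp

lemma ex_linear_functional:
  fixes x :: "'a::complex_algebra"
  assumes "x \<noteq> 0"
  obtains f :: "'a \<Rightarrow> complex" where "clinear f" "f x = 1"
proof -
  interpret vector_space_pair "scaleC :: complex \<Rightarrow> 'a \<Rightarrow> 'a" "scaleC :: complex \<Rightarrow> complex \<Rightarrow> complex"
    by (simp add: vector_space_pair_def cvec.vector_space_axioms)
  have "cvec.independent {x}" using assms by (simp add: cvec.dependent_single)
  from linear_independent_extend[OF this, of "\<lambda>_. 1"] show thesis using that by auto
qed

lemma one_notin_bilinear_span:
  "(1 :: ('a::complex_algebra, 'b::complex_algebra) tpair \<Rightarrow>\<^sub>0 complex) \<notin> bilinear_span"
proof
  assume *: "(1 :: ('a, 'b) tpair \<Rightarrow>\<^sub>0 complex) \<in> bilinear_span"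
  obtain f :: "'a \<Rightarrow> complex" where f: "clinear f" "f 1 = 1" by (rule ex_linear_functional[of 1]) simp_all
  obtain g :: "'b \<Rightarrow> complex" where g: "clinear g" "g 1 = 1" by (rule ex_linear_functional[of 1]) simp_all
  have "cbilinear (\<lambda>x y. f x * g y)"
    using f(1) g(1) unfolding cbilinear_def clinear_iff by (simp add: algebra_simps scaleC_complex_def)
  from lin_ext_bilinear_span[OF this *] have "lin_ext (case_tpair (\<lambda>x y. f x * g y)) 1 = 0" .
  moreover have "lin_ext (case_tpair (\<lambda>x y. f x * g y)) 1 = 1"
    using f(2) g(2) by (simp add: lin_ext_1 zero_tpair_def)
  ultimately show False by simp
qed

instantiation tensor :: (complex_algebra, complex_algebra) complex_algebra
begin
lift_definition zero_tensor :: "('a, 'b) tensor" is 0 .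
lift_definition one_tensor :: "('a, 'b) tensor" is 1 .
lift_definition plus_tensor :: "('a, 'b) tensor \<Rightarrow> ('a, 'b) tensor \<Rightarrow> ('a, 'b) tensor" is "(+)"
  by (simp add: add_diff_add cvec.span_add)
lift_definition uminus_tensor :: "('a, 'b) tensor \<Rightarrow> ('a, 'b) tensor" is uminus
  by (simp only: minus_diff_minus cvec.span_neg)
lift_definition minus_tensor :: "('a, 'b) tensor \<Rightarrow> ('a, 'b) tensor \<Rightarrow> ('a, 'b) tensor" is "(-)"
proof -
  fix p p' q q' :: "('a, 'b) tpair \<Rightarrow>\<^sub>0 complex"
  assume "p - p' \<in> bilinear_span" "q - q' \<in> bilinear_span"
  then have "(p - p') - (q - q') \<in> bilinear_span" by (rule cvec.span_diff)
  moreover have "(p - p') - (q - q') = p - q - (p' - q')" by simp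
  ultimately show "p - q - (p' - q') \<in> bilinear_span" by simp
qed
lift_definition times_tensor :: "('a, 'b) tensor \<Rightarrow> ('a, 'b) tensor \<Rightarrow> ('a, 'b) tensor" is "(*)"
proof -
  fix p p' q q' :: "('a, 'b) tpair \<Rightarrow>\<^sub>0 complex"
  assume "p - p' \<in> bilinear_span" "q - q' \<in> bilinear_span"
  moreover have "p * q - p' * q' = p * (q - q') + (p - p') * q'" by (simp add: algebra_simps)
  ultimately show "p * q - p' * q' \<in> bilinear_span"
    by (simp add: cvec.span_add bilinear_span_ideal)
qed
lift_definition scaleC_tensor :: "complex \<Rightarrow> ('a, 'b) tensor \<Rightarrow> ('a, 'b) tensor" is "(*\<^sub>C)"
  by (simp add: cvec.span_scale flip: cvec.scale_right_diff_distrib)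
instance
proof
  show "(0::('a, 'b) tensor) \<noteq> 1"
  proof transfer
    show "(0 :: ('a, 'b) tpair \<Rightarrow>\<^sub>0 complex) - 1 \<notin> bilinear_span"
      using one_notin_bilinear_span cvec.span_neg by force
  qed
qed (transfer, simp add: algebra_simps cvec.span_zero scaleC_add_left scaleC_add_right)+
end

lift_definition pure_tensor :: "'a::complex_algebra \<Rightarrow> 'b::complex_algebra \<Rightarrow> ('a, 'b) tensor"
    (infixr \<open>\<otimes>\<close> 68) is free_pure .

text \<open>The linear map on the tensor product induced by a bilinear map; meaningful only for bilinear
  arguments, for which it does not depend on the representative.\<close>

definition tensor_lift ::
  "('a::complex_algebra \<Rightarrow> 'b::complex_algebra \<Rightarrow> 'c::complex_algebra) \<Rightarrow> ('a, 'b) tensor \<Rightarrow> 'c"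
  where "tensor_lift f t = lin_ext (case_tpair f) (rep_tensor t)"

lemma tensor_lift_abs:
  assumes "cbilinear f"
  shows "tensor_lift f (abs_tensor p) = lin_ext (case_tpair f) p"
proof -
  have "rep_tensor (abs_tensor p) - p \<in> bilinear_span"
    by (rule Quotient3_rep_abs[OF Quotient3_tensor]) (simp add: cvec.span_zero)
  from lin_ext_bilinear_span[OF assms this] show ?thesis
    by (simp add: tensor_lift_def clinear_diff[OF clinear_lin_ext])
qed

lemma tensor_lift_pure: "cbilinear f \<Longrightarrow> tensor_lift f (a \<otimes> b) = f a b"
  by (simp add: pure_tensor_def tensor_lift_abs)

lemma clinear_tensor_lift:
  assumes "cbilinear f"
  shows "clinear (tensor_lift f)"
proof (rule clinearI)
  fix c and s t :: "('a, 'b) tensor"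
  obtain p where p: "s = abs_tensor p" by (metis Quotient3_abs_rep[OF Quotient3_tensor])
  obtain q where q: "t = abs_tensor q" by (metis Quotient3_abs_rep[OF Quotient3_tensor])
  show "tensor_lift f (s + t) = tensor_lift f s + tensor_lift f t"
    by (simp add: p q plus_tensor.abs_eq tensor_lift_abs assms lin_ext_add)
  show "tensor_lift f (c *\<^sub>C s) = c *\<^sub>C tensor_lift f s"
    by (simp add: p scaleC_tensor.abs_eq tensor_lift_abs assms lin_ext_scale)
qed

lemma tensor_mult [simp]: "(a \<otimes> b) * (a' \<otimes> b') = a * a' \<otimes> b * b'"
  by transfer (simp add: mult_single cvec.span_zero)

lemma one_tensor: "1 \<otimes> 1 = (1 :: ('a::complex_algebra, 'b::complex_algebra) tensor)"
  by transfer (simp add: cvec.span_zero flip: zero_tpair_def)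

lemma pure_tensor_add_left: "(a + a') \<otimes> b = (a \<otimes> b) + (a' \<otimes> b)"
  by transfer (rule cvec.span_base, simp add: bilinear_relators diff_diff_add[symmetric])

lemma pure_tensor_add_right: "a \<otimes> (b + b') = (a \<otimes> b) + (a \<otimes> b')"
  by transfer (rule cvec.span_base, simp add: bilinear_relators diff_diff_add[symmetric])

lemma pure_tensor_scaleC_left: "(c *\<^sub>C a) \<otimes> b = c *\<^sub>C (a \<otimes> b)"
  by transfer (rule cvec.span_base, simp add: bilinear_relators)

lemma pure_tensor_scaleC_right: "a \<otimes> (c *\<^sub>C b) = c *\<^sub>C (a \<otimes> b)"
  by transfer (rule cvec.span_base, simp add: bilinear_relators)

lemma cbilinear_pure_tensor: "cbilinear (\<otimes>)"
  by (simp add: cbilinear_def clinear_iff pure_tensor_add_left pure_tensor_add_right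
      pure_tensor_scaleC_left pure_tensor_scaleC_right)

lemma pure_tensor_minus: "(- a) \<otimes> b = - (a \<otimes> b)" "a \<otimes> (- b) = - (a \<otimes> b)"
  using pure_tensor_scaleC_left[of "-1" a b] pure_tensor_scaleC_right[of a "-1" b] by simp_all

lemma pure_tensor_0: "0 \<otimes> b = 0" "a \<otimes> 0 = 0"
  using pure_tensor_scaleC_left[of 0 0 b] pure_tensor_scaleC_right[of a 0 0] by simp_all

lemma pure_tensor_diff: "(a - a') \<otimes> b = (a \<otimes> b) - (a' \<otimes> b)" "a \<otimes> (b - b') = (a \<otimes> b) - (a \<otimes> b')"
  using pure_tensor_add_left[of a "- a'" b] pure_tensor_add_right[of a b "- b'"]
  by (simp_all add: pure_tensor_minus)

definition tensor_map :: "('a::complex_algebra \<Rightarrow> 'c::complex_algebra)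
    \<Rightarrow> ('b::complex_algebra \<Rightarrow> 'd::complex_algebra) \<Rightarrow> ('a, 'b) tensor \<Rightarrow> ('c, 'd) tensor"
    (infixr \<open>\<otimes>\<^sub>m\<close> 68)
  where "f \<otimes>\<^sub>m g = tensor_lift (\<lambda>x y. f x \<otimes> g y)"

lemma cbilinear_tensor_map:
  assumes "clinear f" "clinear g"
  shows "cbilinear (\<lambda>x y. f x \<otimes> g y)"
  using assms unfolding cbilinear_def clinear_iff
  by (simp add: pure_tensor_add_left pure_tensor_add_right
      pure_tensor_scaleC_left pure_tensor_scaleC_right)

lemma clinear_tensor_map: "clinear f \<Longrightarrow> clinear g \<Longrightarrow> clinear (f \<otimes>\<^sub>m g)"
  unfolding tensor_map_def by (intro clinear_tensor_lift cbilinear_tensor_map)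

lemma tensor_map_pure: "clinear f \<Longrightarrow> clinear g \<Longrightarrow> (f \<otimes>\<^sub>m g) (a \<otimes> b) = f a \<otimes> g b"
  unfolding tensor_map_def by (subst tensor_lift_pure) (auto intro: cbilinear_tensor_map)

text \<open>The linear map on a threefold tensor product induced by a trilinear map.\<close>

definition tensor_lift3 ::
  "('a::complex_algebra \<Rightarrow> 'b::complex_algebra \<Rightarrow> 'c::complex_algebra \<Rightarrow> 'd::complex_algebra)
    \<Rightarrow> ('a, ('b, 'c) tensor) tensor \<Rightarrow> 'd"
  where "tensor_lift3 f = tensor_lift (\<lambda>x. tensor_lift (f x))"

lemma clinear_tensor_lift_param:
  fixes f :: "'a::complex_algebra \<Rightarrow> 'b::complex_algebra \<Rightarrow> 'c::complex_algebra \<Rightarrow> 'd::complex_algebra"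
  assumes "\<And>y z. clinear (\<lambda>x. f x y z)"
  shows "clinear (\<lambda>x. tensor_lift (f x) t)"
proof -
  have lin_ext_add_fun: "lin_ext (case_tpair (\<lambda>y z. g y z + h y z)) p
      = lin_ext (case_tpair g) p + lin_ext (case_tpair h) p" for g h :: "'b \<Rightarrow> 'c \<Rightarrow> 'd" and p
    unfolding lin_ext_def sum.distrib[symmetric]
    by (rule sum.cong) (simp_all add: scaleC_add_right split: tpair.split)
  have lin_ext_scale_fun: "lin_ext (case_tpair (\<lambda>y z. c *\<^sub>C g y z)) p
      = c *\<^sub>C lin_ext (case_tpair g) p" for g :: "'b \<Rightarrow> 'c \<Rightarrow> 'd" and c p
    unfolding lin_ext_def cvec.scale_sum_right
    by (rule sum.cong) (simp_all add: mult.commute[of c] split: tpair.split)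
  have "f (x + x') y z = f x y z + f x' y z" "f (c *\<^sub>C x) y z = c *\<^sub>C f x y z" for x x' y z c
    using assms[of y z] by (simp_all add: clinear_iff)
  then have "f (x + x') = (\<lambda>y z. f x y z + f x' y z)" "f (c *\<^sub>C x) = (\<lambda>y z. c *\<^sub>C f x y z)" for x x' c
    by (intro ext, simp)+
  then show ?thesis
    by (intro clinearI) (simp_all add: tensor_lift_def lin_ext_add_fun lin_ext_scale_fun)
qed

lemma cbilinear_tensor_lift3:
  assumes "\<And>x. cbilinear (f x)" "\<And>y z. clinear (\<lambda>x. f x y z)"
  shows "cbilinear (\<lambda>x. tensor_lift (f x))"
  unfolding cbilinear_def by (intro conjI allI clinear_tensor_lift clinear_tensor_lift_param assms)

lemma tensor_lift3_pure:
  assumes "\<And>x. cbilinear (f x)" "\<And>y z. clinear (\<lambda>x. f x y z)"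
  shows "tensor_lift3 f (x \<otimes> y \<otimes> z) = f x y z"
  unfolding tensor_lift3_def
  by (simp add: tensor_lift_pure cbilinear_tensor_lift3 assms)

definition tensor_assoc :: "(('a::complex_algebra, 'b::complex_algebra) tensor, 'c::complex_algebra) tensor
    \<Rightarrow> ('a, ('b, 'c) tensor) tensor"
  where "tensor_assoc = tensor_lift (\<lambda>t z. tensor_lift (\<lambda>x y. x \<otimes> y \<otimes> z) t)"

lemma tensor_assoc_pure: "tensor_assoc ((x \<otimes> y) \<otimes> z) = x \<otimes> y \<otimes> z"
  and clinear_tensor_assoc: "clinear (tensor_assoc :: (('a, 'b) tensor, 'c) tensor \<Rightarrow> _)"
  for x :: "'a::complex_algebra" and y :: "'b::complex_algebra" and z :: "'c::complex_algebra"
proof -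
  have bil: "cbilinear (\<lambda>x y. x \<otimes> y \<otimes> z)" for z :: 'c
    unfolding cbilinear_def clinear_iff
    by (simp add: pure_tensor_add_left pure_tensor_add_right
        pure_tensor_scaleC_left pure_tensor_scaleC_right)
  have "cbilinear (\<lambda>t z. tensor_lift (\<lambda>x y. (x::'a) \<otimes> (y::'b) \<otimes> (z::'c)) t)"
    unfolding cbilinear_def
  proof (intro conjI allI clinear_tensor_lift bil)
    show "clinear (\<lambda>z. tensor_lift (\<lambda>x y. (x::'a) \<otimes> (y::'b) \<otimes> (z::'c)) t)" for t
      by (rule clinear_tensor_lift_param) (simp add: clinear_iff pure_tensor_add_right pure_tensor_scaleC_right)
  qed
  then show "tensor_assoc ((x \<otimes> y) \<otimes> z) = x \<otimes> y \<otimes> z"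
    "clinear (tensor_assoc :: (('a, 'b) tensor, 'c) tensor \<Rightarrow> _)"
    unfolding tensor_assoc_def
    by (simp_all only: tensor_lift_pure bil clinear_tensor_lift)
qed

section \<open>Quasi-triangular quasi-Hopf algebras\<close>

text \<open>Tensor powers are nested to the right, e.g. \<open>A\<close>, \<open>A \<otimes> A\<close>, \<open>A \<otimes> (A \<otimes> A)\<close>; the canonical
  re-bracketing \<^const>\<open>tensor_assoc\<close> is inserted where a map produces another bracketing.
  In \<open>leg_ijk\<close>, the first, second, third tensor factor of the result is the \<open>i\<close>-th, \<open>j\<close>-th, \<open>k\<close>-th
  factor of the argument.\<close>

type_synonym 'a tensor2 = "('a, 'a) tensor"
type_synonym 'a tensor3 = "('a, 'a tensor2) tensor"
type_synonym 'a tensor4 = "('a, 'a tensor3) tensor"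

definition leg_21 :: "'a::complex_algebra tensor2 \<Rightarrow> 'a tensor2"
  where "leg_21 = tensor_lift (\<lambda>x y. y \<otimes> x)"
definition leg_132 :: "'a::complex_algebra tensor3 \<Rightarrow> 'a tensor3"
  where "leg_132 = tensor_lift3 (\<lambda>x y z. x \<otimes> z \<otimes> y)"
definition leg_213 :: "'a::complex_algebra tensor3 \<Rightarrow> 'a tensor3"
  where "leg_213 = tensor_lift3 (\<lambda>x y z. y \<otimes> x \<otimes> z)"
definition leg_231 :: "'a::complex_algebra tensor3 \<Rightarrow> 'a tensor3"
  where "leg_231 = tensor_lift3 (\<lambda>x y z. y \<otimes> z \<otimes> x)"
definition leg_312 :: "'a::complex_algebra tensor3 \<Rightarrow> 'a tensor3"
  where "leg_312 = tensor_lift3 (\<lambda>x y z. z \<otimes> x \<otimes> y)"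

definition in_12 :: "'a::complex_algebra tensor2 \<Rightarrow> 'a tensor3"
  where "in_12 = tensor_lift (\<lambda>x y. x \<otimes> y \<otimes> 1)"
definition in_13 :: "'a::complex_algebra tensor2 \<Rightarrow> 'a tensor3"
  where "in_13 = tensor_lift (\<lambda>x y. x \<otimes> 1 \<otimes> y)"
definition in_23 :: "'a::complex_algebra tensor2 \<Rightarrow> 'a tensor3"
  where "in_23 t = 1 \<otimes> t"
definition in_123 :: "'a::complex_algebra tensor3 \<Rightarrow> 'a tensor4"
  where "in_123 = tensor_lift3 (\<lambda>x y z. x \<otimes> y \<otimes> z \<otimes> 1)"
definition in_234 :: "'a::complex_algebra tensor3 \<Rightarrow> 'a tensor4"
  where "in_234 t = 1 \<otimes> t"

locale quasi_bialgebra =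
  fixes \<Delta> :: "'a::complex_algebra \<Rightarrow> 'a tensor2"
    and \<epsilon> :: "'a \<Rightarrow> complex"
    and \<Phi> :: "'a tensor3"
  assumes hom_\<Delta>: "algebra_hom \<Delta>"
    and hom_\<epsilon>: "algebra_hom \<epsilon>"
    and inverse_\<Phi>: "has_inverse \<Phi>"
    and counit_left: "tensor_lift (\<lambda>x y. \<epsilon> x *\<^sub>C y) (\<Delta> a) = a"
    and counit_right: "tensor_lift (\<lambda>x y. \<epsilon> y *\<^sub>C x) (\<Delta> a) = a"
    and quasi_coassociative:
      "tensor_assoc ((\<Delta> \<otimes>\<^sub>m id) (\<Delta> a)) = \<Phi> * (id \<otimes>\<^sub>m \<Delta>) (\<Delta> a) * the_inverse \<Phi>"
    and counit_\<Phi>: "tensor_lift3 (\<lambda>x y z. \<epsilon> y *\<^sub>C (x \<otimes> z)) \<Phi> = 1 \<otimes> 1"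
    and pentagon:
      "tensor_assoc ((\<Delta> \<otimes>\<^sub>m id \<otimes>\<^sub>m id) \<Phi>) * (id \<otimes>\<^sub>m id \<otimes>\<^sub>m \<Delta>) \<Phi>
        = in_123 \<Phi> * (id \<otimes>\<^sub>m (\<lambda>t. tensor_assoc ((\<Delta> \<otimes>\<^sub>m id) t))) \<Phi> * in_234 \<Phi>"

locale quasi_triangular_quasi_bialgebra = quasi_bialgebra \<Delta> \<epsilon> \<Phi>
  for \<Delta> :: "'a::complex_algebra \<Rightarrow> 'a tensor2" and \<epsilon> \<Phi> +
  fixes R :: "'a tensor2"
  assumes inverse_R: "has_inverse R"
    and R_\<Delta>: "R * \<Delta> a = leg_21 (\<Delta> a) * R"
    and hexagon_left: "tensor_assoc ((\<Delta> \<otimes>\<^sub>m id) R)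
      = the_inverse (leg_231 \<Phi>) * in_13 R * leg_132 \<Phi> * in_23 R * the_inverse \<Phi>"
    and hexagon_right: "(id \<otimes>\<^sub>m \<Delta>) R
      = leg_312 \<Phi> * in_13 R * the_inverse (leg_213 \<Phi>) * in_12 R * \<Phi>"

locale quasi_hopf_algebra = quasi_bialgebra \<Delta> \<epsilon> \<Phi>
  for \<Delta> :: "'a::complex_algebra \<Rightarrow> 'a tensor2" and \<epsilon> \<Phi> +
  fixes S :: "'a \<Rightarrow> 'a" and ev coev :: 'a
  assumes antihom_S: "algebra_antihom S"
    and antipode_ev: "tensor_lift (\<lambda>x y. S x * ev * y) (\<Delta> a) = \<epsilon> a *\<^sub>C ev"
    and antipode_coev: "tensor_lift (\<lambda>x y. x * coev * S y) (\<Delta> a) = \<epsilon> a *\<^sub>C coev"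
    and zigzag: "tensor_lift3 (\<lambda>x y z. S x * ev * y * coev * S z) \<Phi> = 1"
    and zigzag_inverse: "tensor_lift3 (\<lambda>x y z. x * coev * S y * ev * z) (the_inverse \<Phi>) = 1"

locale quasi_triangular_quasi_hopf_algebra =
  quasi_hopf_algebra \<Delta> \<epsilon> \<Phi> S ev coev + quasi_triangular_quasi_bialgebra \<Delta> \<epsilon> \<Phi> R
  for \<Delta> :: "'a::complex_algebra \<Rightarrow> 'a tensor2" and \<epsilon> \<Phi> R S ev coev

section \<open>The algebra \<open>Q\<close> by generators and relations\<close>

datatype 'g word = Word "'g list"

instantiation word :: (type) monoid_add
begin
definition zero_word :: "'a word" where "0 = Word []"
fun plus_word :: "'a word \<Rightarrow> 'a word \<Rightarrow> 'a word" where "Word u + Word v = Word (u @ v)"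
instance
proof
  fix x y z :: "'a word"
  show "x + y + z = x + (y + z)" by (cases x; cases y; cases z) simp
  show "0 + x = x" "x + 0 = x" by (cases x; simp add: zero_word_def)+
qed
end

type_synonym 'g free_algebra = "'g word \<Rightarrow>\<^sub>0 complex"

definition free_gen :: "'g \<Rightarrow> 'g free_algebra"
  where "free_gen g = Poly_Mapping.single (Word [g]) 1"

fun word_prod :: "('g \<Rightarrow> 'a::monoid_mult) \<Rightarrow> 'g word \<Rightarrow> 'a"
  where "word_prod f (Word gs) = prod_list (map f gs)"

fun word_rev_prod :: "('g \<Rightarrow> 'a::monoid_mult) \<Rightarrow> 'g word \<Rightarrow> 'a"
  where "word_rev_prod f (Word gs) = prod_list (map f (rev gs))"

definition free_hom :: "('g \<Rightarrow> 'a::complex_algebra) \<Rightarrow> 'g free_algebra \<Rightarrow> 'a"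
  where "free_hom f = lin_ext (word_prod f)"

definition free_antihom :: "('g \<Rightarrow> 'a::complex_algebra) \<Rightarrow> 'g free_algebra \<Rightarrow> 'a"
  where "free_antihom f = lin_ext (word_rev_prod f)"

lemma algebra_hom_free_hom: "algebra_hom (free_hom f)"
  unfolding free_hom_def
proof (rule algebra_hom_lin_ext)
  show "word_prod f (m + n) = word_prod f m * word_prod f n" for m n
    by (cases m; cases n) simp
qed (simp add: zero_word_def)

lemma algebra_antihom_free_antihom: "algebra_antihom (free_antihom f)"
  unfolding free_antihom_def
proof (rule algebra_antihom_lin_ext)
  show "word_rev_prod f (m + n) = word_rev_prod f n * word_rev_prod f m" for m n
    by (cases m; cases n) simp
qed (simp add: zero_word_def)

lemma free_hom_gen: "free_hom f (free_gen g) = f g"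
  by (simp add: free_hom_def free_gen_def)

lemma free_antihom_gen: "free_antihom f (free_gen g) = f g"
  by (simp add: free_antihom_def free_gen_def)

inductive_set two_sided_ideal :: "'a::ring_1 set \<Rightarrow> 'a set" for X
  where
    zero: "0 \<in> two_sided_ideal X"
  | base: "x \<in> X \<Longrightarrow> x \<in> two_sided_ideal X"
  | add: "p \<in> two_sided_ideal X \<Longrightarrow> q \<in> two_sided_ideal X \<Longrightarrow> p + q \<in> two_sided_ideal X"
  | left: "p \<in> two_sided_ideal X \<Longrightarrow> q * p \<in> two_sided_ideal X"
  | right: "p \<in> two_sided_ideal X \<Longrightarrow> p * q \<in> two_sided_ideal X"

lemma two_sided_ideal_neg: "p \<in> two_sided_ideal X \<Longrightarrow> - p \<in> two_sided_ideal X"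
  using two_sided_ideal.left[of p X "-1"] by simp

lemma hom_two_sided_ideal:
  assumes "algebra_hom h" "\<And>x. x \<in> X \<Longrightarrow> h x = 0" "p \<in> two_sided_ideal X"
  shows "h p = 0"
  using assms(3) by induction (use assms(1,2) in \<open>simp_all add: algebra_hom_def clinear_add clinear_0\<close>)

lemma antihom_two_sided_ideal:
  assumes "algebra_antihom h" "\<And>x. x \<in> X \<Longrightarrow> h x = 0" "p \<in> two_sided_ideal X"
  shows "h p = 0"
  using assms(3) by induction (use assms(1,2) in \<open>simp_all add: algebra_antihom_def clinear_add clinear_0\<close>)

datatype gen = gen_E | gen_F | gen_K | gen_Kinv

definition Q_relators :: "gen free_algebra set"
  where "Q_relators = (let E = free_gen gen_E; F = free_gen gen_F; K = free_gen gen_K; K' = free_gen gen_Kinv in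
    {K * K' - 1, K' * K - 1, K * E * K' + E, K * F * K' + F,
     (E * F - F * E) - (1 / (2 * \<i>)) *\<^sub>C (K - K'), E\<^sup>2, F\<^sup>2, K ^ 4 - 1})"

lemma hom_Q_ideal:
  assumes "p - q \<in> two_sided_ideal Q_relators"
    and "f gen_K * f gen_Kinv = 1" "f gen_Kinv * f gen_K = 1"
    and "f gen_K * f gen_E * f gen_Kinv = - f gen_E" "f gen_K * f gen_F * f gen_Kinv = - f gen_F"
    and "f gen_E * f gen_F - f gen_F * f gen_E = (1 / (2 * \<i>)) *\<^sub>C (f gen_K - f gen_Kinv)"
    and "f gen_E * f gen_E = 0" "f gen_F * f gen_F = 0" "f gen_K * f gen_K * f gen_K * f gen_K = 1"
  shows "free_hom f p = free_hom f q"
proof -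
  have h: "clinear (free_hom f)" "free_hom f 1 = 1" "free_hom f (x * y) = free_hom f x * free_hom f y" for x y
    using algebra_hom_free_hom[of f] by (auto simp: algebra_hom_def)
  have "free_hom f r = 0" if "r \<in> Q_relators" for r
    using that assms(2-)
    by (auto simp: Q_relators_def Let_def h clinear_diff clinear_add clinear_scale free_hom_gen
        power2_eq_square power4_eq_xxxx)
  from hom_two_sided_ideal[OF algebra_hom_free_hom this assms(1)]
  show ?thesis by (simp add: clinear_diff[OF h(1)])
qed

lemma antihom_Q_ideal:
  assumes "p - q \<in> two_sided_ideal Q_relators"
    and "f gen_K * f gen_Kinv = 1" "f gen_Kinv * f gen_K = 1"
    and "f gen_Kinv * (f gen_E * f gen_K) = - f gen_E" "f gen_Kinv * (f gen_F * f gen_K) = - f gen_F"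
    and "f gen_F * f gen_E - f gen_E * f gen_F = (1 / (2 * \<i>)) *\<^sub>C (f gen_K - f gen_Kinv)"
    and "f gen_E * f gen_E = 0" "f gen_F * f gen_F = 0" "f gen_K * (f gen_K * (f gen_K * f gen_K)) = 1"
  shows "free_antihom f p = free_antihom f q"
proof -
  have h: "clinear (free_antihom f)" "free_antihom f 1 = 1"
    "free_antihom f (x * y) = free_antihom f y * free_antihom f x" for x y
    using algebra_antihom_free_antihom[of f] by (auto simp: algebra_antihom_def)
  have "free_antihom f r = 0" if "r \<in> Q_relators" for r
    using that assms(2-)
    by (auto simp: Q_relators_def Let_def h clinear_diff clinear_add clinear_scale free_antihom_gen
        power2_eq_square power4_eq_xxxx)
  from antihom_two_sided_ideal[OF algebra_antihom_free_antihom this assms(1)]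
  show ?thesis by (simp add: clinear_diff[OF h(1)])
qed

quotient_type Q = "gen free_algebra" / "\<lambda>p q. p - q \<in> two_sided_ideal Q_relators"
proof (rule equivpI)
  let ?I = "two_sided_ideal Q_relators"
  show "reflp (\<lambda>p q. p - q \<in> ?I)" by (simp add: reflp_def two_sided_ideal.zero)
  show "symp (\<lambda>p q. p - q \<in> ?I)"
    unfolding symp_def using two_sided_ideal_neg by fastforce
  show "transp (\<lambda>p q. p - q \<in> ?I)"
    unfolding transp_def using two_sided_ideal.add by fastforce
qed

lemma one_notin_Q_ideal: "1 \<notin> two_sided_ideal Q_relators"
proof
  define \<epsilon> :: "gen \<Rightarrow> complex" where "\<epsilon> = case_gen 0 0 1 1"
  assume "1 \<in> two_sided_ideal Q_relators"
  then have "1 - 0 \<in> two_sided_ideal Q_relators" by simp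
  then have "free_hom \<epsilon> 1 = free_hom \<epsilon> 0" by (rule hom_Q_ideal) (simp_all add: \<epsilon>_def)
  then show False
    using algebra_hom_free_hom[of \<epsilon>] clinear_0[of "free_hom \<epsilon>"] by (simp add: algebra_hom_def)
qed

instantiation Q :: complex_algebra
begin
lift_definition zero_Q :: Q is 0 .
lift_definition one_Q :: Q is 1 .
lift_definition plus_Q :: "Q \<Rightarrow> Q \<Rightarrow> Q" is "(+)"
  by (simp add: add_diff_add two_sided_ideal.add)
lift_definition uminus_Q :: "Q \<Rightarrow> Q" is uminus
  by (simp only: minus_diff_minus two_sided_ideal_neg)
lift_definition minus_Q :: "Q \<Rightarrow> Q \<Rightarrow> Q" is "(-)"
proof -
  fix p p' q q' :: "gen free_algebra"
  assume "p - p' \<in> two_sided_ideal Q_relators" "q - q' \<in> two_sided_ideal Q_relators"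
  then have "(p - p') + - (q - q') \<in> two_sided_ideal Q_relators"
    by (intro two_sided_ideal.add two_sided_ideal_neg)
  moreover have "(p - p') + - (q - q') = p - q - (p' - q')" by simp
  ultimately show "p - q - (p' - q') \<in> two_sided_ideal Q_relators" by metis
qed
lift_definition times_Q :: "Q \<Rightarrow> Q \<Rightarrow> Q" is "(*)"
proof -
  fix p p' q q' :: "gen free_algebra"
  assume "p - p' \<in> two_sided_ideal Q_relators" "q - q' \<in> two_sided_ideal Q_relators"
  moreover have "p * q - p' * q' = p * (q - q') + (p - p') * q'" by (simp add: algebra_simps)
  ultimately show "p * q - p' * q' \<in> two_sided_ideal Q_relators"
    by (simp add: two_sided_ideal.add two_sided_ideal.left two_sided_ideal.right)
qed
lift_definition scaleC_Q :: "complex \<Rightarrow> Q \<Rightarrow> Q" is "(*\<^sub>C)"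
proof -
  fix c and p q :: "gen free_algebra"
  assume "p - q \<in> two_sided_ideal Q_relators"
  then have "(c *\<^sub>C 1) * (p - q) \<in> two_sided_ideal Q_relators" by (rule two_sided_ideal.left)
  then show "c *\<^sub>C p - c *\<^sub>C q \<in> two_sided_ideal Q_relators"
    by (simp add: cvec.scale_right_diff_distrib)
qed
instance
proof
  show "(0::Q) \<noteq> 1"
  proof transfer
    show "(0 :: gen free_algebra) - 1 \<notin> two_sided_ideal Q_relators"
      using one_notin_Q_ideal two_sided_ideal_neg by force
  qed
qed (transfer, simp add: algebra_simps two_sided_ideal.zero scaleC_add_left scaleC_add_right)+
end

lift_definition E :: Q is "free_gen gen_E" .
lift_definition F :: Q is "free_gen gen_F" .
lift_definition K :: Q is "free_gen gen_K" .
lift_definition Kinv :: Q is "free_gen gen_Kinv" .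

lemma Q_rels:
  "K * Kinv = 1" "Kinv * K = 1" "K * E * Kinv = - E" "K * F * Kinv = - F"
  "E * F - F * E = (1 / (2 * \<i>)) *\<^sub>C (K - Kinv)" "E\<^sup>2 = 0" "F\<^sup>2 = 0" "K ^ 4 = 1"
  unfolding power2_eq_square power4_eq_xxxx
  by (transfer, rule two_sided_ideal.base,
      simp add: Q_relators_def Let_def power2_eq_square power4_eq_xxxx)+

lemma Q_rewrites:
  "K * Kinv = 1" "Kinv * K = 1" "K * E = - (E * K)" "K * F = - (F * K)"
  "Kinv * E = - (E * Kinv)" "Kinv * F = - (F * Kinv)"
  "E * E = 0" "F * F = 0" "K * (K * (K * K)) = 1" "Kinv * (Kinv * (Kinv * Kinv)) = 1"
  "E * F = F * E + (1 / (2 * \<i>)) *\<^sub>C (K - Kinv)"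
proof -
  show KK: "K * Kinv = 1" "Kinv * K = 1" by (rule Q_rels)+
  show K4: "K * (K * (K * K)) = 1" using Q_rels(8) by (simp add: power4_eq_xxxx mult.assoc)
  show "E * E = 0" "F * F = 0" using Q_rels(6,7) by (simp_all add: power2_eq_square)
  have move: "K * x = - (x * K) \<and> Kinv * x = - (x * Kinv)" if "K * x * Kinv = - x" for x
  proof
    have "K * x = K * x * (Kinv * K)" by (simp add: KK)
    also have "\<dots> = - x * K" using that by (simp flip: mult.assoc)
    finally show *: "K * x = - (x * K)" by simp
    have "Kinv * x = - (Kinv * (K * x * Kinv))" using that by simp
    also have "\<dots> = - (Kinv * K * x * Kinv)" by (simp only: mult.assoc)
    finally show "Kinv * x = - (x * Kinv)" by (simp add: KK)
  qed
  show "K * E = - (E * K)" "K * F = - (F * K)" "Kinv * E = - (E * Kinv)" "Kinv * F = - (F * Kinv)"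
    using move Q_rels(3,4) by auto
  have "Kinv * (Kinv * (Kinv * Kinv)) = Kinv * (Kinv * (Kinv * (Kinv * (K * (K * (K * K))))))"
    by (simp add: K4)
  also have "\<dots> = Kinv * (Kinv * (Kinv * (Kinv * K) * K) * K) * K" by (simp only: mult.assoc)
  also have "\<dots> = 1" by (simp add: KK)
  finally show "Kinv * (Kinv * (Kinv * Kinv)) = 1" .
  show "E * F = F * E + (1 / (2 * \<i>)) *\<^sub>C (K - Kinv)"
    using Q_rels(5) by (simp add: algebra_simps)
qed

lemma Q_rewrites_assoc:
  "K * (Kinv * x) = x" "Kinv * (K * x) = x" "K * (E * x) = - (E * (K * x))"
  "K * (F * x) = - (F * (K * x))" "Kinv * (E * x) = - (E * (Kinv * x))"
  "Kinv * (F * x) = - (F * (Kinv * x))" "E * (E * x) = 0" "F * (F * x) = 0"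
  "E * (F * x) = F * (E * x) + (1 / (2 * \<i>)) *\<^sub>C (K * x - Kinv * x)"
  by (simp_all add: Q_rewrites left_diff_distrib distrib_right flip: mult.assoc)

fun Delta_gen :: "gen \<Rightarrow> Q tensor2"
  where
    "Delta_gen gen_E = (1 \<otimes> E) + (E \<otimes> K)"
  | "Delta_gen gen_F = (Kinv \<otimes> F) + (F \<otimes> 1)"
  | "Delta_gen gen_K = K \<otimes> K"
  | "Delta_gen gen_Kinv = Kinv \<otimes> Kinv"

fun epsilon_gen :: "gen \<Rightarrow> complex"
  where
    "epsilon_gen gen_E = 0"
  | "epsilon_gen gen_F = 0"
  | "epsilon_gen gen_K = 1"
  | "epsilon_gen gen_Kinv = 1"

fun S_gen :: "gen \<Rightarrow> Q"
  where
    "S_gen gen_E = - (E * Kinv)"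
  | "S_gen gen_F = - (K * F)"
  | "S_gen gen_K = Kinv"
  | "S_gen gen_Kinv = K"

lift_definition epsilon :: "Q \<Rightarrow> complex" is "free_hom epsilon_gen"
  by (erule hom_Q_ideal) simp_all

lift_definition Delta :: "Q \<Rightarrow> Q tensor2" is "free_hom Delta_gen"
  by (erule hom_Q_ideal)
    (simp_all add: mult.assoc Q_rewrites Q_rewrites_assoc one_tensor distrib_left distrib_right left_diff_distrib
      pure_tensor_add_left pure_tensor_add_right pure_tensor_scaleC_left pure_tensor_scaleC_right
      pure_tensor_minus pure_tensor_0 pure_tensor_diff cvec.scale_right_diff_distrib)

lift_definition S :: "Q \<Rightarrow> Q" is "free_antihom S_gen"
  by (erule antihom_Q_ideal)
    (simp_all add: mult.assoc Q_rewrites Q_rewrites_assoc cvec.scale_right_diff_distrib)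

lemma Delta_generators:
  "Delta E = (1 \<otimes> E) + (E \<otimes> K)" "Delta F = (Kinv \<otimes> F) + (F \<otimes> 1)"
  "Delta K = K \<otimes> K" "Delta Kinv = Kinv \<otimes> Kinv"
  by (simp_all add: Delta.abs_eq E_def F_def K_def Kinv_def free_hom_gen)

lemma epsilon_generators: "epsilon E = 0" "epsilon F = 0" "epsilon K = 1" "epsilon Kinv = 1"
  by (simp_all add: epsilon.abs_eq E_def F_def K_def Kinv_def free_hom_gen)

lemma S_generators: "S E = - (E * Kinv)" "S F = - (K * F)" "S K = Kinv" "S Kinv = K"
  by (simp_all add: S.abs_eq E_def F_def K_def Kinv_def free_antihom_gen)

lemma abs_Q_cases: obtains p where "x = abs_Q p"
  by (metis Quotient3_abs_rep[OF Quotient3_Q])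

lemma algebra_hom_Delta: "algebra_hom Delta"
  unfolding algebra_hom_def clinear_iff
proof (intro conjI allI)
  have h: "clinear (free_hom Delta_gen)" "free_hom Delta_gen 1 = 1"
    "free_hom Delta_gen (p * q) = free_hom Delta_gen p * free_hom Delta_gen q" for p q
    using algebra_hom_free_hom[of Delta_gen] by (auto simp: algebra_hom_def)
  fix x y c
  obtain p q where "x = abs_Q p" "y = abs_Q q" using abs_Q_cases by metis
  then show "Delta (x + y) = Delta x + Delta y" "Delta (c *\<^sub>C x) = c *\<^sub>C Delta x"
    "Delta (x * y) = Delta x * Delta y" "Delta 1 = 1"
    by (simp_all add: Delta.abs_eq plus_Q.abs_eq scaleC_Q.abs_eq times_Q.abs_eq one_Q_def
        h clinear_add clinear_scale)
qed

lemma algebra_hom_epsilon: "algebra_hom epsilon"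
  unfolding algebra_hom_def clinear_iff
proof (intro conjI allI)
  have h: "clinear (free_hom epsilon_gen)" "free_hom epsilon_gen 1 = 1"
    "free_hom epsilon_gen (p * q) = free_hom epsilon_gen p * free_hom epsilon_gen q" for p q
    using algebra_hom_free_hom[of epsilon_gen] by (auto simp: algebra_hom_def)
  fix x y c
  obtain p q where "x = abs_Q p" "y = abs_Q q" using abs_Q_cases by metis
  then show "epsilon (x + y) = epsilon x + epsilon y" "epsilon (c *\<^sub>C x) = c *\<^sub>C epsilon x"
    "epsilon (x * y) = epsilon x * epsilon y" "epsilon 1 = 1"
    by (simp_all add: epsilon.abs_eq plus_Q.abs_eq scaleC_Q.abs_eq times_Q.abs_eq one_Q_def
        h clinear_add clinear_scale)
qed

lemma algebra_antihom_S: "algebra_antihom S"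
  unfolding algebra_antihom_def clinear_iff
proof (intro conjI allI)
  have h: "clinear (free_antihom S_gen)" "free_antihom S_gen 1 = 1"
    "free_antihom S_gen (p * q) = free_antihom S_gen q * free_antihom S_gen p" for p q
    using algebra_antihom_free_antihom[of S_gen] by (auto simp: algebra_antihom_def)
  fix x y c
  obtain p q where "x = abs_Q p" "y = abs_Q q" using abs_Q_cases by metis
  then show "S (x + y) = S x + S y" "S (c *\<^sub>C x) = c *\<^sub>C S x" "S (x * y) = S y * S x" "S 1 = 1"
    by (simp_all add: S.abs_eq plus_Q.abs_eq scaleC_Q.abs_eq times_Q.abs_eq one_Q_def
        h clinear_add clinear_scale)
qed

section \<open>Coassociator, coevaluation element and R-matrix\<close>

definition idem0 :: Q (\<open>e\<^sub>0\<close>) where "e\<^sub>0 = (1/2) *\<^sub>C (1 + K\<^sup>2)"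
definition idem1 :: Q (\<open>e\<^sub>1\<close>) where "e\<^sub>1 = (1/2) *\<^sub>C (1 - K\<^sup>2)"

definition Phi010 :: "Q tensor3"
  where "Phi010 =
       (1 \<otimes> 1 \<otimes> 1) - (1 + \<i>) *\<^sub>C (E \<otimes> K \<otimes> F)
       + (1 - \<i>) *\<^sub>C (F * K \<otimes> K \<otimes> E * K)
       + 2 *\<^sub>C (E * F * K \<otimes> 1 \<otimes> E * F * K)"

definition Phi101 :: "Q tensor3"
  where "Phi101 =
       (\<i> - 1) *\<^sub>C (1 \<otimes> F \<otimes> E * K) + (1 \<otimes> K \<otimes> 1)
       + 2 *\<^sub>C (1 \<otimes> E * F \<otimes> E * F * K)
       - (1 + \<i>) *\<^sub>C (1 \<otimes> E * K \<otimes> F)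
       - (1 + \<i>) *\<^sub>C (E \<otimes> F * K \<otimes> 1)
       + (2 * \<i>) *\<^sub>C (E \<otimes> E * F * K \<otimes> F)
       + (1 - \<i>) *\<^sub>C (F * K \<otimes> E \<otimes> 1)
       - (2 * \<i>) *\<^sub>C (F * K \<otimes> E * F * K \<otimes> E * K)
       - 2 *\<^sub>C (E * F * K \<otimes> E * F \<otimes> 1)"

definition Phi111 :: "complex \<Rightarrow> Q tensor3"
  where "Phi111 \<beta> = (\<i> * \<beta>\<^sup>2) *\<^sub>C
      ((1 + \<i>) *\<^sub>C (1 \<otimes> F \<otimes> E * K) - (1 \<otimes> K \<otimes> 1)
       - 2 *\<^sub>C (1 \<otimes> E * F \<otimes> 1)
       - (2 * \<i>) *\<^sub>C (1 \<otimes> E * F \<otimes> E * F * K)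
       + (1 + \<i>) *\<^sub>C (1 \<otimes> E * K \<otimes> F)
       - (1 + \<i>) *\<^sub>C (E \<otimes> 1 \<otimes> F)
       + (1 + \<i>) *\<^sub>C (E \<otimes> F * K \<otimes> 1)
       + (2 * \<i>) *\<^sub>C (E \<otimes> F * K \<otimes> E * F * K)
       + 2 *\<^sub>C (E \<otimes> E * F * K \<otimes> F)
       - (1 + \<i>) *\<^sub>C (F * K \<otimes> 1 \<otimes> E * K)
       + (1 + \<i>) *\<^sub>C (F * K \<otimes> E \<otimes> 1)
       + (2 * \<i>) *\<^sub>C (F * K \<otimes> E \<otimes> E * F * K)
       + 2 *\<^sub>C (F * K \<otimes> E * F * K \<otimes> E * K)
       + (2 * \<i>) *\<^sub>C (E * F * K \<otimes> F \<otimes> E * K)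
       + (2 * \<i>) *\<^sub>C (E * F * K \<otimes> K \<otimes> E * F * K)
       - (2 * \<i>) *\<^sub>C (E * F * K \<otimes> E * F \<otimes> 1)
       + (2 * \<i>) *\<^sub>C (E * F * K \<otimes> E * K \<otimes> F)
       + 4 *\<^sub>C (E * F * K \<otimes> E * F \<otimes> E * F * K))"

definition Phi :: "complex \<Rightarrow> Q tensor3"
  where "Phi \<beta> = (e\<^sub>0 \<otimes> e\<^sub>0 \<otimes> e\<^sub>0) + (e\<^sub>1 \<otimes> e\<^sub>0 \<otimes> e\<^sub>0)
       + Phi010 * (e\<^sub>0 \<otimes> e\<^sub>1 \<otimes> e\<^sub>0)
       + (e\<^sub>0 \<otimes> e\<^sub>0 \<otimes> e\<^sub>1) + (e\<^sub>1 \<otimes> e\<^sub>1 \<otimes> e\<^sub>0)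
       + Phi101 * (e\<^sub>1 \<otimes> e\<^sub>0 \<otimes> e\<^sub>1)
       + (e\<^sub>0 \<otimes> e\<^sub>1 \<otimes> e\<^sub>1)
       + Phi111 \<beta> * (e\<^sub>1 \<otimes> e\<^sub>1 \<otimes> e\<^sub>1)"

definition casimir :: Q
  where "casimir = F * E - (\<i>/4) *\<^sub>C (K - Kinv)"

definition evaluation :: Q
  where "evaluation = 1"

definition coevaluation :: "complex \<Rightarrow> Q"
  where "coevaluation \<beta> = e\<^sub>0 - (2 * \<i> * \<beta>\<^sup>2) *\<^sub>C (casimir * e\<^sub>1)"

definition R00 :: "Q tensor2"
  where "R00 = (1/2) *\<^sub>C ((1 \<otimes> 1) + (1 \<otimes> K) + (K \<otimes> 1) - (K \<otimes> K))
       * ((1 \<otimes> 1) + (2 * \<i>) *\<^sub>C (E \<otimes> F))"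

definition R01 :: "Q tensor2"
  where "R01 = (1/2) *\<^sub>C ((1 \<otimes> 1) - \<i> *\<^sub>C (1 \<otimes> K) + (K \<otimes> 1)
       + \<i> *\<^sub>C (K \<otimes> K))
       * ((1 \<otimes> 1) + (1 - \<i>) *\<^sub>C (F * K \<otimes> E * K)
       - (1 - \<i>) *\<^sub>C (E \<otimes> F) + (1 + \<i>) *\<^sub>C (E * F * K \<otimes> 1)
       + (2 * \<i>) *\<^sub>C (E * F * K \<otimes> E * F * K))"

definition R10 :: "Q tensor2"
  where "R10 = (1/2) *\<^sub>C ((1 \<otimes> 1) + (1 \<otimes> K) - \<i> *\<^sub>C (K \<otimes> 1)
       + \<i> *\<^sub>C (K \<otimes> K))
       * ((1 \<otimes> K) + (1 - \<i>) *\<^sub>C (F * K \<otimes> E)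
       + (1 - \<i>) *\<^sub>C (E \<otimes> F * K) - (1 - \<i>) *\<^sub>C (1 \<otimes> E * F)
       - (2 * \<i>) *\<^sub>C (E * F * K \<otimes> E * F))"

definition R11 :: "complex \<Rightarrow> Q tensor2"
  where "R11 \<beta> = (\<beta>/2) *\<^sub>C ((1 \<otimes> 1) - \<i> *\<^sub>C (1 \<otimes> K) - \<i> *\<^sub>C (K \<otimes> 1)
       + (K \<otimes> K))
       * ((- \<i>) *\<^sub>C (K \<otimes> 1) + (2 * \<i>) *\<^sub>C (E * K \<otimes> F)
       + (1 - \<i>) *\<^sub>C (K \<otimes> E * F * K) - (1 + \<i>) *\<^sub>C (E * F \<otimes> 1)
       - (2 * \<i>) *\<^sub>C (E * F \<otimes> E * F * K))"

definition R_matrix :: "complex \<Rightarrow> Q tensor2"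
  where "R_matrix \<beta> = R00 * (e\<^sub>0 \<otimes> e\<^sub>0) + R01 * (e\<^sub>0 \<otimes> e\<^sub>1)
       + R10 * (e\<^sub>1 \<otimes> e\<^sub>0) + R11 \<beta> * (e\<^sub>1 \<otimes> e\<^sub>1)"

end

theory Submission
  imports Defs
begin

text \<open>\<open>Q\<close> is spanned by the 16 monomials \<open>E\<^sup>a F\<^sup>b \<kappa>\<^sup>k e\<^sub>s\<close>, so every axiom that is linear in an element of \<open>Q\<close>
  reduces to these monomials, and the remaining axioms are single identities in \<open>Q\<close>, \<open>Q \<otimes> Q\<close>,
  \<open>Q \<otimes> Q \<otimes> Q\<close> and \<open>Q \<otimes> Q \<otimes> Q \<otimes> Q\<close>. Elements with coefficients in \<open>\<int>[\<beta>]\<close> are represented by nested sparse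
  linear combinations of monomials with an executable product, and all identities become finite
  calculations, carried out by rewriting for the two possible signs in \<open>\<i> = \<plusminus>\<beta>\<^sup>2\<close>. The
  inverses of \<open>\<Phi>\<close> and \<open>R\<close> are explicit in each sector \<open>e\<^sub>a \<otimes> e\<^sub>b (\<otimes> e\<^sub>c)\<close>: \<open>\<Phi>\<close> is an involution in sector
  101, and the prefactor of \<open>R\<close> in \<open>K\<close> is an involution in every sector.\<close>

section \<open>Arithmetic of linear combinations of monomials\<close>

text \<open>\<open>Cyc a b c d\<close> stands for \<open>a + b \<beta> + c \<beta>\<^sup>2 + d \<beta>\<^sup>3\<close>, where \<open>\<beta>\<^sup>4 = -1\<close>.\<close>

datatype cyc = Cyc int int int int

text \<open>No laws are assumed: the lists below are not normal forms, cancelled terms stay with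
  coefficient 0, and ring laws hold only after evaluation. For this reason \<open>vanishes\<close>
  is a test of its own and not equality with \<open>0\<close>.\<close>

class rep = zero + one + plus + minus + uminus + times +
  fixes scl :: "cyc \<Rightarrow> 'a \<Rightarrow> 'a" (infixr \<open>\<bullet>\<close> 75) and vanishes :: "'a \<Rightarrow> bool"

instantiation cyc :: rep
begin

definition zero_cyc :: cyc where "0 = Cyc 0 0 0 0"
definition one_cyc :: cyc where "1 = Cyc 1 0 0 0"
fun plus_cyc :: "cyc \<Rightarrow> cyc \<Rightarrow> cyc"
  where "Cyc a b c d + Cyc a' b' c' d' = Cyc (a + a') (b + b') (c + c') (d + d')"
fun minus_cyc :: "cyc \<Rightarrow> cyc \<Rightarrow> cyc"
  where "Cyc a b c d - Cyc a' b' c' d' = Cyc (a - a') (b - b') (c - c') (d - d')"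
fun uminus_cyc :: "cyc \<Rightarrow> cyc"
  where "- Cyc a b c d = Cyc (- a) (- b) (- c) (- d)"
fun times_cyc :: "cyc \<Rightarrow> cyc \<Rightarrow> cyc"
  where "Cyc a b c d * Cyc a' b' c' d' =
    Cyc (a * a' - b * d' - c * c' - d * b') (a * b' + b * a' - c * d' - d * c')
      (a * c' + b * b' + c * a' - d * d') (a * d' + b * c' + c * b' + d * a')"
definition scl_cyc :: "cyc \<Rightarrow> cyc \<Rightarrow> cyc" where "scl_cyc = (*)"
fun vanishes_cyc :: "cyc \<Rightarrow> bool"
  where "vanishes (Cyc a b c d) \<longleftrightarrow> a = 0 \<and> b = 0 \<and> c = 0 \<and> d = 0"

instance ..

end

text \<open>\<open>Mono s a b k\<close> stands for \<open>E\<^sup>a F\<^sup>b \<kappa>\<^sup>k e\<^sub>s\<close> with \<open>\<kappa> = K e\<^sub>0 - \<i> K e\<^sub>1\<close>: since \<open>\<kappa>\<^sup>2 = 1\<close> and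
  \<open>F E = E F - \<kappa> e\<^sub>1\<close>, all structure constants in this basis are signs, unlike in the basis with \<open>K\<close>.
  The nested type \<open>cyc comb comb\<close> then represents \<open>Q \<otimes> Q\<close>, and so on.\<close>

datatype mono = Mono bool bool bool bool

datatype 'r comb = Comb "(mono \<times> 'r) list"

text \<open>\<open>True\<close> in the first component of an entry means a minus sign. The first
  entry arises by moving \<kappa> past \<open>E\<close> and \<open>F\<close>, with one sign for each
  letter. The second is the correction from \<open>F * E = E * F - \<kappa> * e\<^sub>1\<close>,
  present only in the sector of \<open>e\<^sub>1\<close>; it contributes one more factor
  \<kappa>.\<close>

fun mono_mult :: "mono \<Rightarrow> mono \<Rightarrow> (bool \<times> mono) list"
  where "mono_mult (Mono s a b k) (Mono s' a' b' k') =
    (if s \<noteq> s' then []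
     else (if a \<and> a' \<or> b \<and> b' then []
           else [(k \<and> a' \<noteq> b', Mono s (a \<or> a') (b \<or> b') (k \<noteq> k'))]) @
       (if s \<and> b \<and> a' then [(\<not> k \<and> \<not> b', Mono s a b' (k = k'))] else []))"

fun insert_term :: "mono \<Rightarrow> 'r::rep \<Rightarrow> (mono \<times> 'r) list \<Rightarrow> (mono \<times> 'r) list"
  where
    "insert_term m x [] = [(m, x)]"
  | "insert_term m x ((n, y) # ys) = (if m = n then (n, x + y) # ys else (n, y) # insert_term m x ys)"

fun insert_terms :: "(bool \<times> mono) list \<Rightarrow> 'r::rep \<Rightarrow> (mono \<times> 'r) list \<Rightarrow> (mono \<times> 'r) list"
  where
    "insert_terms [] x ys = ys"
  | "insert_terms ((neg, m) # ts) x ys = insert_terms ts x (insert_term m (if neg then - x else x) ys)"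

text \<open>The case split saves the product \<open>x * y\<close> of the remaining tensor legs whenever the product of
  the first legs vanishes.\<close>

fun insert_prod :: "(bool \<times> mono) list \<Rightarrow> 'r::rep \<Rightarrow> 'r \<Rightarrow> (mono \<times> 'r) list \<Rightarrow> (mono \<times> 'r) list"
  where
    "insert_prod [] x y zs = zs"
  | "insert_prod (t # ts) x y zs = insert_terms (t # ts) (x * y) zs"

fun mult_row :: "mono \<Rightarrow> 'r::rep \<Rightarrow> (mono \<times> 'r) list \<Rightarrow> (mono \<times> 'r) list \<Rightarrow> (mono \<times> 'r) list"
  where
    "mult_row m x [] zs = zs"
  | "mult_row m x ((n, y) # ys) zs = mult_row m x ys (insert_prod (mono_mult m n) x y zs)"

fun mult_rows :: "(mono \<times> 'r::rep) list \<Rightarrow> (mono \<times> 'r) list \<Rightarrow> (mono \<times> 'r) list \<Rightarrow> (mono \<times> 'r) list"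
  where
    "mult_rows [] ys zs = zs"
  | "mult_rows ((m, x) # xs) ys zs = mult_rows xs ys (mult_row m x ys zs)"

fun add_rows :: "(mono \<times> 'r::rep) list \<Rightarrow> (mono \<times> 'r) list \<Rightarrow> (mono \<times> 'r) list"
  where
    "add_rows [] ys = ys"
  | "add_rows ((m, x) # xs) ys = add_rows xs (insert_term m x ys)"

fun map_row :: "('r \<Rightarrow> 's) \<Rightarrow> (mono \<times> 'r) list \<Rightarrow> (mono \<times> 's) list"
  where
    "map_row f [] = []"
  | "map_row f ((m, x) # xs) = (m, f x) # map_row f xs"

fun vanishes_row :: "(mono \<times> 'r::rep) list \<Rightarrow> bool"
  where
    "vanishes_row [] \<longleftrightarrow> True"
  | "vanishes_row ((m, x) # xs) \<longleftrightarrow> vanishes x \<and> vanishes_row xs"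

fun map_coeffs :: "('r \<Rightarrow> 's) \<Rightarrow> 'r comb \<Rightarrow> 's comb"
  where "map_coeffs f (Comb xs) = Comb (map_row f xs)"

instantiation comb :: (rep) rep
begin

definition zero_comb :: "'a comb" where "0 = Comb []"
text \<open>The unit is not a monomial but the sum \<open>e\<^sub>0 + e\<^sub>1\<close>.\<close>

definition one_comb :: "'a comb"
  where "1 = Comb [(Mono False False False False, 1), (Mono True False False False, 1)]"
fun plus_comb :: "'a comb \<Rightarrow> 'a comb \<Rightarrow> 'a comb"
  where "Comb xs + Comb ys = Comb (add_rows xs ys)"
definition uminus_comb :: "'a comb \<Rightarrow> 'a comb" where "- p = map_coeffs uminus p"
definition minus_comb :: "'a comb \<Rightarrow> 'a comb \<Rightarrow> 'a comb" where "(p :: 'a comb) - q = p + - q"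
fun times_comb :: "'a comb \<Rightarrow> 'a comb \<Rightarrow> 'a comb"
  where "Comb xs * Comb ys = Comb (mult_rows xs ys [])"
definition scl_comb :: "cyc \<Rightarrow> 'a comb \<Rightarrow> 'a comb" where "g \<bullet> p = map_coeffs (scl g) p"
fun vanishes_comb :: "'a comb \<Rightarrow> bool" where "vanishes (Comb xs) \<longleftrightarrow> vanishes_row xs"

instance ..

end

fun linear_row :: "(mono \<Rightarrow> 'r \<Rightarrow> 's::rep) \<Rightarrow> (mono \<times> 'r) list \<Rightarrow> 's"
  where
    "linear_row f [] = 0"
  | "linear_row f ((m, x) # xs) = f m x + linear_row f xs"

fun linear_comb :: "(mono \<Rightarrow> 'r \<Rightarrow> 's::rep) \<Rightarrow> 'r comb \<Rightarrow> 's"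
  where "linear_comb f (Comb xs) = linear_row f xs"

text \<open>Coefficients of the left factor are absorbed by the right one, so that in nested
  combinations only the innermost level carries elements of \<open>cyc\<close>.\<close>

definition tensor_rep :: "cyc comb \<Rightarrow> 'r::rep \<Rightarrow> 'r comb" (infixr \<open>\<otimes>\<^sub>r\<close> 68)
  where "p \<otimes>\<^sub>r x = map_coeffs (\<lambda>c. c \<bullet> x) p"

section \<open>Soundness of the arithmetic\<close>

definition kappa :: Q (\<open>\<kappa>\<close>) where "\<kappa> = K * e\<^sub>0 - \<i> *\<^sub>C (K * e\<^sub>1)"

fun mono_val :: "mono \<Rightarrow> Q"
  where "mono_val (Mono s a b k) =
    (if a then E else 1) * ((if b then F else 1) * ((if k then \<kappa> else 1) * (if s then e\<^sub>1 else e\<^sub>0)))"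

section \<open>Relations of \<open>Q\<close> in terms of the idempotents and \<kappa>\<close>

lemma Kinv_K: "Kinv = K * (K * K)"
proof -
  have "Kinv = Kinv * (K * (K * (K * K)))" by (simp add: Q_rewrites)
  also have "\<dots> = K * (K * K)" by (simp only: Q_rewrites_assoc)
  finally show ?thesis .
qed

lemma K4_assoc: "K * (K * (K * (K * x))) = x"
proof -
  have "K * (K * (K * (K * x))) = (K * (K * (K * K))) * x" by (simp only: mult.assoc)
  then show ?thesis by (simp add: Q_rewrites)
qed

lemmas Q_normalize = idem0_def idem1_def kappa_def Kinv_K Q_rewrites Q_rewrites_assoc K4_assoc
  power2_eq_square mult.assoc distrib_left distrib_right left_diff_distrib right_diff_distrib
  cvec.scale_right_diff_distrib scaleC_add_right

lemma scaleC_half_double: "(1/2) *\<^sub>C (x + x) = x"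
  by (simp add: scaleC_add_right flip: scaleC_add_left)

lemma idem_sum: "e\<^sub>0 + e\<^sub>1 = 1"
proof -
  have "e\<^sub>0 + e\<^sub>1 = (1/2) *\<^sub>C ((1 + K\<^sup>2) + (1 - K\<^sup>2))"
    unfolding idem0_def idem1_def by (rule scaleC_add_right[symmetric])
  also have "(1 + K\<^sup>2) + (1 - K\<^sup>2) = (1 + 1 :: Q)" by simp
  finally show ?thesis by (simp only: scaleC_half_double)
qed

text \<open>Since \<open>K ^ 4 = 1\<close>, multiplication by \<open>K\<^sup>2\<close> swaps the two
  summands of each idempotent, up to sign.\<close>

lemma K_idem: "K * (K * e\<^sub>0) = e\<^sub>0" "K * (K * e\<^sub>1) = - e\<^sub>1"
  by (simp_all add: Q_normalize)

lemma idem_mult: "e\<^sub>0 * e\<^sub>0 = e\<^sub>0" "e\<^sub>1 * e\<^sub>1 = e\<^sub>1" "e\<^sub>0 * e\<^sub>1 = 0" "e\<^sub>1 * e\<^sub>0 = 0"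
proof -
  have "e\<^sub>0 * x = (1/2) *\<^sub>C (x + K * (K * x))" "e\<^sub>1 * x = (1/2) *\<^sub>C (x - K * (K * x))" for x
    by (simp_all add: idem0_def idem1_def power2_eq_square distrib_right left_diff_distrib mult.assoc)
  then show "e\<^sub>0 * e\<^sub>0 = e\<^sub>0" "e\<^sub>1 * e\<^sub>1 = e\<^sub>1" "e\<^sub>0 * e\<^sub>1 = 0" "e\<^sub>1 * e\<^sub>0 = 0"
    by (simp_all add: K_idem scaleC_half_double)
qed

text \<open>\<open>K\<close> anticommutes with \<open>E\<close> and \<open>F\<close>, so
  \<open>K\<^sup>2\<close> commutes with them.\<close>

lemma idem_central: "e\<^sub>0 * E = E * e\<^sub>0" "e\<^sub>1 * E = E * e\<^sub>1" "e\<^sub>0 * F = F * e\<^sub>0" "e\<^sub>1 * F = F * e\<^sub>1"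
  "e\<^sub>0 * K = K * e\<^sub>0" "e\<^sub>1 * K = K * e\<^sub>1"
  by (simp_all add: idem0_def idem1_def power2_eq_square distrib_left distrib_right left_diff_distrib
      right_diff_distrib mult.assoc Q_rewrites Q_rewrites_assoc)


text \<open>The factor -\<i> in the sector of \<open>e\<^sub>1\<close> compensates
  \<open>K\<^sup>2 = -1\<close> there, which makes \<kappa> an involution.\<close>

lemma kappa_rules:
  "\<kappa> * E = - (E * \<kappa>)" "\<kappa> * F = - (F * \<kappa>)" "e\<^sub>0 * \<kappa> = \<kappa> * e\<^sub>0" "e\<^sub>1 * \<kappa> = \<kappa> * e\<^sub>1" "\<kappa> * \<kappa> = 1"
  "F * E = E * F - \<kappa> * e\<^sub>1"
proof -
  have sc: "e\<^sub>0 * (K * x) = K * (e\<^sub>0 * x)" "e\<^sub>1 * (K * x) = K * (e\<^sub>1 * x)" for x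
    by (simp_all add: idem_central flip: mult.assoc)
  show "\<kappa> * E = - (E * \<kappa>)" "\<kappa> * F = - (F * \<kappa>)"
    by (simp_all add: kappa_def left_diff_distrib right_diff_distrib mult.assoc idem_central Q_rewrites_assoc)
  show "e\<^sub>0 * \<kappa> = \<kappa> * e\<^sub>0" "e\<^sub>1 * \<kappa> = \<kappa> * e\<^sub>1"
    by (simp_all add: kappa_def left_diff_distrib right_diff_distrib mult.assoc idem_central sc idem_mult)
  have "\<kappa> * \<kappa> = e\<^sub>0 + e\<^sub>1"
    by (simp add: kappa_def left_diff_distrib right_diff_distrib mult.assoc sc idem_mult K_idem)
  then show "\<kappa> * \<kappa> = 1" by (simp only: idem_sum)
  have "E * F - F * E = (1 / (2 * \<i>)) *\<^sub>C ((K - Kinv) * (e\<^sub>0 + e\<^sub>1))"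
    by (simp add: Q_rewrites idem_sum)
  \<comment> \<open>\<open>K\<close> and \<open>Kinv\<close> agree in the sector of
    \<open>e\<^sub>0\<close> and are opposite in that of \<open>e\<^sub>1\<close>, so the commutator
    lives in the latter only.\<close>
  also have "(K - Kinv) * (e\<^sub>0 + e\<^sub>1) = K * e\<^sub>1 + K * e\<^sub>1"
    by (simp add: Kinv_K distrib_left left_diff_distrib mult.assoc K_idem)
  also have "(1 / (2 * \<i>)) *\<^sub>C (K * e\<^sub>1 + K * e\<^sub>1) = (- \<i>) *\<^sub>C (1/2) *\<^sub>C (K * e\<^sub>1 + K * e\<^sub>1)"
    by simp
  also have "\<dots> = \<kappa> * e\<^sub>1"
    unfolding scaleC_half_double by (simp add: kappa_def left_diff_distrib mult.assoc idem_mult)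
  finally show "F * E = E * F - \<kappa> * e\<^sub>1" by (simp add: algebra_simps)
qed

lemmas mono_rules = idem_mult idem_central(1-4) kappa_rules Q_rewrites(7,8)

lemma mono_rules_assoc:
  "e\<^sub>0 * (e\<^sub>0 * x) = e\<^sub>0 * x" "e\<^sub>1 * (e\<^sub>1 * x) = e\<^sub>1 * x" "e\<^sub>0 * (e\<^sub>1 * x) = 0" "e\<^sub>1 * (e\<^sub>0 * x) = 0"
  "e\<^sub>0 * (E * x) = E * (e\<^sub>0 * x)" "e\<^sub>1 * (E * x) = E * (e\<^sub>1 * x)"
  "e\<^sub>0 * (F * x) = F * (e\<^sub>0 * x)" "e\<^sub>1 * (F * x) = F * (e\<^sub>1 * x)"
  "\<kappa> * (E * x) = - (E * (\<kappa> * x))" "\<kappa> * (F * x) = - (F * (\<kappa> * x))"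
  "e\<^sub>0 * (\<kappa> * x) = \<kappa> * (e\<^sub>0 * x)" "e\<^sub>1 * (\<kappa> * x) = \<kappa> * (e\<^sub>1 * x)" "\<kappa> * (\<kappa> * x) = x"
  "E * (E * x) = 0" "F * (F * x) = 0"
  "F * (E * x) = E * (F * x) - \<kappa> * (e\<^sub>1 * x)"
  by (simp_all add: mono_rules left_diff_distrib flip: mult.assoc)

definition signed_mono :: "bool \<times> mono \<Rightarrow> Q"
  where "signed_mono t = (if fst t then - mono_val (snd t) else mono_val (snd t))"

text \<open>The rules bring every product into the order \<open>E\<close>, \<open>F\<close>,
  \<kappa>, idempotent, so each choice of the eight exponents is settled by normalization.\<close>

lemma mono_mult_sound:
  "mono_val m * mono_val n = sum_list (map signed_mono (mono_mult m n))"
proof -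
  obtain s a b k where m: "m = Mono s a b k" by (cases m)
  obtain s' a' b' k' where n: "n = Mono s' a' b' k'" by (cases n)
  show ?thesis
    unfolding m n
    by (cases s; cases s'; cases b; cases a'; cases a; cases b'; cases k; cases k')
      (simp_all add: signed_mono_def mult.assoc mono_rules mono_rules_assoc right_diff_distrib left_diff_distrib)
qed

section \<open>Evaluation of nested combinations in the tensor powers of \<open>Q\<close>\<close>

fun cyc_val :: "complex \<Rightarrow> cyc \<Rightarrow> complex"
  where "cyc_val \<beta> (Cyc a b c d) = of_int a + of_int b * \<beta> + of_int c * \<beta>\<^sup>2 + of_int d * \<beta> ^ 3"

text \<open>The parameter \<open>ten\<close> is scalar multiplication at the innermost level and
  \<otimes> at all others, so that one soundness proof serves every level.\<close>

fun row_val :: "(Q \<Rightarrow> 'a \<Rightarrow> 'b) \<Rightarrow> ('r \<Rightarrow> 'a) \<Rightarrow> (mono \<times> 'r) list \<Rightarrow> 'b::complex_algebra"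
  where
    "row_val ten ev [] = 0"
  | "row_val ten ev ((m, x) # xs) = ten (mono_val m) (ev x) + row_val ten ev xs"

fun comb_val :: "(Q \<Rightarrow> 'a \<Rightarrow> 'b) \<Rightarrow> ('r \<Rightarrow> 'a) \<Rightarrow> 'r comb \<Rightarrow> 'b::complex_algebra"
  where "comb_val ten ev (Comb xs) = row_val ten ev xs"

text \<open>Evaluation respects all operations. For \<open>vanishes\<close> only one implication is
  required: a positive test proves an identity.\<close>

locale representation =
  fixes \<beta> :: complex and ev :: "'r::rep \<Rightarrow> 'a::complex_algebra"
  assumes ev_0 [simp]: "ev 0 = 0"
    and ev_1 [simp]: "ev 1 = 1"
    and ev_add [simp]: "ev (x + y) = ev x + ev y"
    and ev_diff [simp]: "ev (x - y) = ev x - ev y"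
    and ev_uminus [simp]: "ev (- x) = - ev x"
    and ev_mult [simp]: "ev (x * y) = ev x * ev y"
    and ev_scl [simp]: "ev (g \<bullet> x) = cyc_val \<beta> g *\<^sub>C ev x"
    and ev_vanishes: "vanishes x \<Longrightarrow> ev x = 0"

lemma representation_cyc:
  assumes "\<beta> ^ 4 = -1"
  shows "representation \<beta> (cyc_val \<beta>)"
proof
  have \<beta>4: "\<beta> * (\<beta> * (\<beta> * \<beta>)) = -1" using assms by (simp add: power4_eq_xxxx mult.assoc)
  have \<beta>4_assoc: "\<beta> * (\<beta> * (\<beta> * (\<beta> * z))) = - z" for z
  proof -
    have "\<beta> * (\<beta> * (\<beta> * (\<beta> * z))) = (\<beta> * (\<beta> * (\<beta> * \<beta>))) * z" by (simp only: mult.assoc)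
    then show ?thesis by (simp add: \<beta>4)
  qed
  fix x y g :: cyc
  show mult: "cyc_val \<beta> (x * y) = cyc_val \<beta> x * cyc_val \<beta> y" for x y
    by (cases x; cases y) (simp add: \<beta>4 \<beta>4_assoc power2_eq_square power3_eq_cube algebra_simps)
  show "cyc_val \<beta> (g \<bullet> x) = cyc_val \<beta> g *\<^sub>C cyc_val \<beta> x"
    by (simp add: scl_cyc_def mult scaleC_complex_def)
  show "cyc_val \<beta> 0 = 0" "cyc_val \<beta> 1 = 1" by (simp_all add: zero_cyc_def one_cyc_def)
  show "cyc_val \<beta> (x + y) = cyc_val \<beta> x + cyc_val \<beta> y" "cyc_val \<beta> (x - y) = cyc_val \<beta> x - cyc_val \<beta> y"
    "cyc_val \<beta> (- x) = - cyc_val \<beta> x"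
    by (cases x; cases y; simp add: algebra_simps)+
  show "cyc_val \<beta> x = 0" if "vanishes x" using that by (cases x) simp
qed

text \<open>This is the induction step on the number of tensor legs: \<open>'a\<close> is the
  algebra of the coefficients, \<open>'b\<close> the algebra with one more leg.\<close>

locale tensor_step = representation \<beta> ev
  for \<beta> and ev :: "'r::rep \<Rightarrow> 'a::complex_algebra" +
  fixes ten :: "Q \<Rightarrow> 'a \<Rightarrow> 'b::complex_algebra"
  assumes bilinear: "cbilinear ten"
    and ten_mult: "ten x u * ten y v = ten (x * y) (u * v)"
    and ten_one: "ten 1 1 = 1"
begin

lemma ten_simps:
  "ten (x + y) u = ten x u + ten y u" "ten x (u + v) = ten x u + ten x v"
  "ten (c *\<^sub>C x) u = c *\<^sub>C ten x u" "ten x (c *\<^sub>C u) = c *\<^sub>C ten x u"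
  "ten (- x) u = - ten x u" "ten x (- u) = - ten x u" "ten 0 u = 0" "ten x 0 = 0"
  using bilinear unfolding cbilinear_def
  by (simp_all add: clinear_add clinear_scale clinear_uminus clinear_0
      clinear_add[of "\<lambda>x. ten x u"] clinear_scale[of "\<lambda>x. ten x u"] clinear_uminus[of "\<lambda>x. ten x u"]
      clinear_0[of "\<lambda>x. ten x u"])

abbreviation "rval \<equiv> row_val ten ev"

lemma insert_term: "rval (insert_term m x ys) = ten (mono_val m) (ev x) + rval ys"
  by (induction m x ys rule: insert_term.induct) (simp_all add: ten_simps)

lemma insert_terms:
  "rval (insert_terms ts x ys) = ten (sum_list (map signed_mono ts)) (ev x) + rval ys"
  by (induction ts x ys rule: insert_terms.induct)
    (simp_all add: insert_term ten_simps signed_mono_def)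

lemma insert_prod:
  "rval (insert_prod ts x y zs) = ten (sum_list (map signed_mono ts)) (ev x * ev y) + rval zs"
  by (cases ts) (simp_all add: ten_simps insert_terms del: insert_terms.simps)

lemma mult_row: "rval (mult_row m x ys zs) = ten (mono_val m) (ev x) * rval ys + rval zs"
  by (induction m x ys zs rule: mult_row.induct)
    (simp_all add: insert_prod distrib_left ten_mult flip: mono_mult_sound)

lemma mult_rows: "rval (mult_rows xs ys zs) = rval xs * rval ys + rval zs"
  by (induction xs ys zs rule: mult_rows.induct) (simp_all add: mult_row distrib_right)

lemma add_rows: "rval (add_rows xs ys) = rval xs + rval ys"
  by (induction xs ys rule: add_rows.induct) (simp_all add: insert_term)

lemma representation_comb: "representation \<beta> (comb_val ten ev)"
proof
  have uminus: "comb_val ten ev (- p) = - comb_val ten ev p" for p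
  proof (cases p)
    case (Comb xs)
    show ?thesis unfolding Comb by (induction xs) (auto simp: uminus_comb_def ten_simps)
  qed
  have add: "comb_val ten ev (p + q) = comb_val ten ev p + comb_val ten ev q" for p q
    by (cases p; cases q) (simp add: add_rows)
  fix p q :: "'r comb" and g
  show "comb_val ten ev (- p) = - comb_val ten ev p" by (rule uminus)
  show "comb_val ten ev (p + q) = comb_val ten ev p + comb_val ten ev q" by (rule add)
  show "comb_val ten ev (p - q) = comb_val ten ev p - comb_val ten ev q"
    by (simp add: minus_comb_def add uminus)
  show "comb_val ten ev (p * q) = comb_val ten ev p * comb_val ten ev q"
    by (cases p; cases q) (simp add: mult_rows)
  show "comb_val ten ev (g \<bullet> p) = cyc_val \<beta> g *\<^sub>C comb_val ten ev p"
  proof (cases p)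
    case (Comb xs)
    show ?thesis unfolding Comb by (induction xs) (auto simp: scl_comb_def ten_simps scaleC_add_right)
  qed
  show "comb_val ten ev 0 = 0" by (simp add: zero_comb_def)
  have "comb_val ten ev 1 = ten (e\<^sub>0 + e\<^sub>1) 1" by (simp add: one_comb_def ten_simps)
  then show "comb_val ten ev 1 = 1" by (simp add: idem_sum ten_one)
  show "comb_val ten ev p = 0" if "vanishes p"
  proof (cases p)
    case (Comb xs)
    show ?thesis using that unfolding Comb by (induction xs) (auto simp: ev_vanishes ten_simps)
  qed
qed

lemma tensor_rep:
  "comb_val ten ev (p \<otimes>\<^sub>r x) = ten (comb_val (\<lambda>x c. c *\<^sub>C x) (cyc_val \<beta>) p) (ev x)"
proof (cases p)
  case (Comb xs)
  show ?thesis unfolding Comb by (induction xs) (auto simp: tensor_rep_def ten_simps)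
qed

end

text \<open>A linear map is known on representatives once it is known on a monomial in the first leg
  tensored with an arbitrary represented rest.\<close>

lemma linear_comb:
  assumes "representation \<beta> ev'" "clinear T"
    and "\<And>m x. T (ten (mono_val m) (ev x)) = ev' (f m x)"
  shows "T (comb_val ten ev p) = ev' (linear_comb f p)"
proof (cases p)
  case (Comb xs)
  interpret representation \<beta> ev' by fact
  show ?thesis unfolding Comb
    by (induction xs) (auto simp: assms(3) clinear_0[OF assms(2)] clinear_add[OF assms(2)])
qed

text \<open>This variant covers maps that leave the first leg alone, such as the identity tensored
  with a linear map.\<close>

lemma map_coeffs:
  assumes "clinear T"
    and "\<And>m x. T (ten (mono_val m) (ev x)) = ten' (mono_val m) (ev' (f x))"
  shows "T (comb_val ten ev p) = comb_val ten' ev' (map_coeffs f p)"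
proof (cases p)
  case (Comb xs)
  show ?thesis unfolding Comb
    by (induction xs) (auto simp: assms(2) clinear_0[OF assms(1)] clinear_add[OF assms(1)])
qed

section \<open>Representatives of the structure maps\<close>

definition E_rep :: "cyc comb"
  where "E_rep = Comb [(Mono False True False False, 1), (Mono True True False False, 1)]"
definition F_rep :: "cyc comb"
  where "F_rep = Comb [(Mono False False True False, 1), (Mono True False True False, 1)]"
definition e0_rep :: "cyc comb" where "e0_rep = Comb [(Mono False False False False, 1)]"
definition e1_rep :: "cyc comb" where "e1_rep = Comb [(Mono True False False False, 1)]"

text \<open>Since \<open>\<i> = \<plusminus>\<beta>\<^sup>2\<close>, the imaginary unit is \<open>\<tau> \<beta>\<^sup>2\<close> with a sign \<open>\<tau>\<close> depending on \<open>\<beta>\<close>; \<open>gauss \<tau> a b\<close>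
  stands for \<open>a + b \<i>\<close>.\<close>

definition gauss :: "int \<Rightarrow> int \<Rightarrow> int \<Rightarrow> cyc" where "gauss \<tau> a b = Cyc a 0 (b * \<tau>) 0"

text \<open>In the sector of \<open>e\<^sub>1\<close> the definition of \<kappa> inverts to
  \<open>K * e\<^sub>1 = \<i> *\<^sub>C (\<kappa> * e\<^sub>1)\<close>, which explains the
  coefficient \<i>; it is -\<i> for the inverse of \<open>K\<close>.\<close>

definition K_rep :: "int \<Rightarrow> cyc comb"
  where "K_rep \<tau> = Comb [(Mono False False False True, 1), (Mono True False False True, gauss \<tau> 0 1)]"
definition Kinv_rep :: "int \<Rightarrow> cyc comb"
  where "Kinv_rep \<tau> = Comb [(Mono False False False True, 1), (Mono True False False True, gauss \<tau> 0 (-1))]"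

text \<open>The coproduct of \<kappa> is read off from that of \<open>K\<close>, with the factor
  -\<i> in the sector of \<open>e\<^sub>1\<close>. On the idempotents the sector indices add modulo
  2.\<close>

fun Delta_mono :: "int \<Rightarrow> mono \<Rightarrow> cyc comb comb"
  where "Delta_mono \<tau> (Mono s a b k) =
    (if a then (1 \<otimes>\<^sub>r E_rep) + (E_rep \<otimes>\<^sub>r K_rep \<tau>) else 1) *
    ((if b then (Kinv_rep \<tau> \<otimes>\<^sub>r F_rep) + (F_rep \<otimes>\<^sub>r 1) else 1) *
    ((if k then (if s then gauss \<tau> 0 (-1) else 1) \<bullet> (K_rep \<tau> \<otimes>\<^sub>r K_rep \<tau>) else 1) *
    (if s then (e0_rep \<otimes>\<^sub>r e1_rep) + (e1_rep \<otimes>\<^sub>r e0_rep) else (e0_rep \<otimes>\<^sub>r e0_rep) + (e1_rep \<otimes>\<^sub>r e1_rep))))"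

text \<open>The exponent of \<kappa> is free because the counit sends both \<open>e\<^sub>0\<close>
  and \<open>\<kappa> * e\<^sub>0\<close> to 1.\<close>

fun epsilon_mono :: "mono \<Rightarrow> bool"
  where "epsilon_mono (Mono s a b k) \<longleftrightarrow> \<not> s \<and> \<not> a \<and> \<not> b"

fun S_mono :: "int \<Rightarrow> mono \<Rightarrow> cyc comb"
  where "S_mono \<tau> (Mono s a b k) =
    (if s then e1_rep else e0_rep) * ((if k then (if s then gauss \<tau> 0 (-1) else 1) \<bullet> Kinv_rep \<tau> else 1) *
    ((if b then - (K_rep \<tau> * F_rep) else 1) * (if a then - (E_rep * Kinv_rep \<tau>) else 1)))"

locale Q_coefficients =
  fixes \<beta> :: complex and \<tau> :: int
  assumes \<beta>4: "\<beta> ^ 4 = -1" and i_eq: "\<i> = of_int \<tau> * \<beta>\<^sup>2"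
begin

abbreviation val0 :: "cyc \<Rightarrow> complex" where "val0 \<equiv> cyc_val \<beta>"
abbreviation val1 :: "cyc comb \<Rightarrow> Q" where "val1 \<equiv> comb_val (\<lambda>x c. c *\<^sub>C x) val0"
abbreviation val2 :: "cyc comb comb \<Rightarrow> Q tensor2" where "val2 \<equiv> comb_val (\<otimes>) val1"
abbreviation val3 :: "cyc comb comb comb \<Rightarrow> Q tensor3" where "val3 \<equiv> comb_val (\<otimes>) val2"
abbreviation val4 :: "cyc comb comb comb comb \<Rightarrow> Q tensor4" where "val4 \<equiv> comb_val (\<otimes>) val3"

text \<open>The numbering is shifted by one: the rules for evaluating in \<open>val0\<close> to
  \<open>val3\<close> appear under \<open>t1\<close> to \<open>t4\<close>, so those for two legs are
  in \<open>t3\<close>. The rules for four legs are in \<open>r4\<close>.\<close>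

sublocale t1: tensor_step \<beta> val0 "\<lambda>x c. c *\<^sub>C x :: Q"
proof -
  interpret representation \<beta> val0 by (rule representation_cyc[OF \<beta>4])
  show "tensor_step \<beta> val0 (\<lambda>x c. c *\<^sub>C x :: Q)"
    by unfold_locales
      (simp_all add: cbilinear_def clinear_iff scaleC_add_left scaleC_add_right scaleC_complex_def mult.commute)
qed

sublocale t2: tensor_step \<beta> val1 "(\<otimes>) :: Q \<Rightarrow> Q \<Rightarrow> _"
proof -
  interpret representation \<beta> val1 by (rule t1.representation_comb)
  show "tensor_step \<beta> val1 ((\<otimes>) :: Q \<Rightarrow> Q \<Rightarrow> _)"
    by unfold_locales (simp_all add: cbilinear_pure_tensor one_tensor)
qed

sublocale t3: tensor_step \<beta> val2 "(\<otimes>) :: Q \<Rightarrow> Q tensor2 \<Rightarrow> _"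
proof -
  interpret representation \<beta> val2 by (rule t2.representation_comb)
  show "tensor_step \<beta> val2 ((\<otimes>) :: Q \<Rightarrow> Q tensor2 \<Rightarrow> _)"
    by unfold_locales (simp_all add: cbilinear_pure_tensor one_tensor)
qed

sublocale t4: tensor_step \<beta> val3 "(\<otimes>) :: Q \<Rightarrow> Q tensor3 \<Rightarrow> _"
proof -
  interpret representation \<beta> val3 by (rule t3.representation_comb)
  show "tensor_step \<beta> val3 ((\<otimes>) :: Q \<Rightarrow> Q tensor3 \<Rightarrow> _)"
    by unfold_locales (simp_all add: cbilinear_pure_tensor one_tensor)
qed

sublocale r4: representation \<beta> val4 by (rule t4.representation_comb)

lemmas tensor_vals = t2.tensor_rep t3.tensor_rep t4.tensor_rep

lemma gauss_val [simp]: "val0 (gauss \<tau> a b) = of_int a + of_int b * \<i>"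
  by (simp add: gauss_def i_eq)

lemma kappa_idem: "\<kappa> * e\<^sub>0 = K * e\<^sub>0" "\<kappa> * e\<^sub>1 = (- \<i>) *\<^sub>C (K * e\<^sub>1)"
  by (simp_all add: kappa_def left_diff_distrib mult.assoc idem_mult)

lemma split_idem: "x = x * e\<^sub>0 + x * e\<^sub>1" for x :: Q
  by (metis distrib_left idem_sum mult.right_neutral)

lemma generator_vals:
  "val1 E_rep = E" "val1 F_rep = F" "val1 (K_rep \<tau>) = K" "val1 (Kinv_rep \<tau>) = Kinv"
  "val1 e0_rep = e\<^sub>0" "val1 e1_rep = e\<^sub>1"
proof -
  have one: "val0 1 = 1" by (rule t1.ev_1)
  show "val1 E_rep = E" "val1 F_rep = F" "val1 (K_rep \<tau>) = K"
    "val1 e0_rep = e\<^sub>0" "val1 e1_rep = e\<^sub>1"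
    using split_idem[of E] split_idem[of F] split_idem[of K]
    by (simp_all add: E_rep_def F_rep_def K_rep_def e0_rep_def e1_rep_def one kappa_idem
        del: cyc_val.simps)
  show "val1 (Kinv_rep \<tau>) = Kinv"
    using split_idem[of Kinv] by (simp add: Kinv_rep_def one kappa_idem Kinv_K mult.assoc K_idem)
qed

end

section \<open>Representatives of the coassociator, the R-matrix and their inverses\<close>

definition Phi010_rep :: "int \<Rightarrow> cyc comb comb comb"
  where "Phi010_rep \<tau> =
       (1 \<otimes>\<^sub>r 1 \<otimes>\<^sub>r 1) - gauss \<tau> 1 1 \<bullet> (E_rep \<otimes>\<^sub>r K_rep \<tau> \<otimes>\<^sub>r F_rep)
       + gauss \<tau> 1 (-1) \<bullet> (F_rep * K_rep \<tau> \<otimes>\<^sub>r K_rep \<tau> \<otimes>\<^sub>r E_rep * K_rep \<tau>)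
       + gauss \<tau> 2 0 \<bullet> (E_rep * F_rep * K_rep \<tau> \<otimes>\<^sub>r 1 \<otimes>\<^sub>r E_rep * F_rep * K_rep \<tau>)"

definition Phi101_rep :: "int \<Rightarrow> cyc comb comb comb"
  where "Phi101_rep \<tau> =
       gauss \<tau> (-1) 1 \<bullet> (1 \<otimes>\<^sub>r F_rep \<otimes>\<^sub>r E_rep * K_rep \<tau>) + (1 \<otimes>\<^sub>r K_rep \<tau> \<otimes>\<^sub>r 1)
       + gauss \<tau> 2 0 \<bullet> (1 \<otimes>\<^sub>r E_rep * F_rep \<otimes>\<^sub>r E_rep * F_rep * K_rep \<tau>)
       - gauss \<tau> 1 1 \<bullet> (1 \<otimes>\<^sub>r E_rep * K_rep \<tau> \<otimes>\<^sub>r F_rep)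
       - gauss \<tau> 1 1 \<bullet> (E_rep \<otimes>\<^sub>r F_rep * K_rep \<tau> \<otimes>\<^sub>r 1)
       + gauss \<tau> 0 2 \<bullet> (E_rep \<otimes>\<^sub>r E_rep * F_rep * K_rep \<tau> \<otimes>\<^sub>r F_rep)
       + gauss \<tau> 1 (-1) \<bullet> (F_rep * K_rep \<tau> \<otimes>\<^sub>r E_rep \<otimes>\<^sub>r 1)
       - gauss \<tau> 0 2 \<bullet> (F_rep * K_rep \<tau> \<otimes>\<^sub>r E_rep * F_rep * K_rep \<tau> \<otimes>\<^sub>r E_rep * K_rep \<tau>)
       - gauss \<tau> 2 0 \<bullet> (E_rep * F_rep * K_rep \<tau> \<otimes>\<^sub>r E_rep * F_rep \<otimes>\<^sub>r 1)"

text \<open>The prefactor is an integer: \<i> \<beta>^2 = \<tau> \<beta>^4 = -\<tau>.\<close>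

definition Phi111_rep :: "int \<Rightarrow> cyc comb comb comb"
  where "Phi111_rep \<tau> = gauss \<tau> (- \<tau>) 0 \<bullet>
      (gauss \<tau> 1 1 \<bullet> (1 \<otimes>\<^sub>r F_rep \<otimes>\<^sub>r E_rep * K_rep \<tau>) - (1 \<otimes>\<^sub>r K_rep \<tau> \<otimes>\<^sub>r 1)
       - gauss \<tau> 2 0 \<bullet> (1 \<otimes>\<^sub>r E_rep * F_rep \<otimes>\<^sub>r 1)
       - gauss \<tau> 0 2 \<bullet> (1 \<otimes>\<^sub>r E_rep * F_rep \<otimes>\<^sub>r E_rep * F_rep * K_rep \<tau>)
       + gauss \<tau> 1 1 \<bullet> (1 \<otimes>\<^sub>r E_rep * K_rep \<tau> \<otimes>\<^sub>r F_rep)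
       - gauss \<tau> 1 1 \<bullet> (E_rep \<otimes>\<^sub>r 1 \<otimes>\<^sub>r F_rep)
       + gauss \<tau> 1 1 \<bullet> (E_rep \<otimes>\<^sub>r F_rep * K_rep \<tau> \<otimes>\<^sub>r 1)
       + gauss \<tau> 0 2 \<bullet> (E_rep \<otimes>\<^sub>r F_rep * K_rep \<tau> \<otimes>\<^sub>r E_rep * F_rep * K_rep \<tau>)
       + gauss \<tau> 2 0 \<bullet> (E_rep \<otimes>\<^sub>r E_rep * F_rep * K_rep \<tau> \<otimes>\<^sub>r F_rep)
       - gauss \<tau> 1 1 \<bullet> (F_rep * K_rep \<tau> \<otimes>\<^sub>r 1 \<otimes>\<^sub>r E_rep * K_rep \<tau>)
       + gauss \<tau> 1 1 \<bullet> (F_rep * K_rep \<tau> \<otimes>\<^sub>r E_rep \<otimes>\<^sub>r 1)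
       + gauss \<tau> 0 2 \<bullet> (F_rep * K_rep \<tau> \<otimes>\<^sub>r E_rep \<otimes>\<^sub>r E_rep * F_rep * K_rep \<tau>)
       + gauss \<tau> 2 0 \<bullet> (F_rep * K_rep \<tau> \<otimes>\<^sub>r E_rep * F_rep * K_rep \<tau> \<otimes>\<^sub>r E_rep * K_rep \<tau>)
       + gauss \<tau> 0 2 \<bullet> (E_rep * F_rep * K_rep \<tau> \<otimes>\<^sub>r F_rep \<otimes>\<^sub>r E_rep * K_rep \<tau>)
       + gauss \<tau> 0 2 \<bullet> (E_rep * F_rep * K_rep \<tau> \<otimes>\<^sub>r K_rep \<tau> \<otimes>\<^sub>r E_rep * F_rep * K_rep \<tau>)
       - gauss \<tau> 0 2 \<bullet> (E_rep * F_rep * K_rep \<tau> \<otimes>\<^sub>r E_rep * F_rep \<otimes>\<^sub>r 1)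
       + gauss \<tau> 0 2 \<bullet> (E_rep * F_rep * K_rep \<tau> \<otimes>\<^sub>r E_rep * K_rep \<tau> \<otimes>\<^sub>r F_rep)
       + gauss \<tau> 4 0 \<bullet> (E_rep * F_rep * K_rep \<tau> \<otimes>\<^sub>r E_rep * F_rep \<otimes>\<^sub>r E_rep * F_rep * K_rep \<tau>))"

definition Phi_rep :: "int \<Rightarrow> cyc comb comb comb"
  where "Phi_rep \<tau> = (e0_rep \<otimes>\<^sub>r e0_rep \<otimes>\<^sub>r e0_rep) + (e1_rep \<otimes>\<^sub>r e0_rep \<otimes>\<^sub>r e0_rep)
       + Phi010_rep \<tau> * (e0_rep \<otimes>\<^sub>r e1_rep \<otimes>\<^sub>r e0_rep)
       + (e0_rep \<otimes>\<^sub>r e0_rep \<otimes>\<^sub>r e1_rep) + (e1_rep \<otimes>\<^sub>r e1_rep \<otimes>\<^sub>r e0_rep)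
       + Phi101_rep \<tau> * (e1_rep \<otimes>\<^sub>r e0_rep \<otimes>\<^sub>r e1_rep)
       + (e0_rep \<otimes>\<^sub>r e1_rep \<otimes>\<^sub>r e1_rep)
       + Phi111_rep \<tau> * (e1_rep \<otimes>\<^sub>r e1_rep \<otimes>\<^sub>r e1_rep)"

text \<open>To keep the coefficients integral, the factors \<open>1/2\<close> of the R-matrix and of its inverse are left out:
  \<open>R_matrix_rep\<close> represents \<open>2 R\<close>, and \<open>R_matrix_inv_rep\<close> represents \<open>2 R\<^sup>-\<^sup>1\<close>.\<close>

definition R00_rep :: "int \<Rightarrow> cyc comb comb"
  where "R00_rep \<tau> = ((1 \<otimes>\<^sub>r 1) + (1 \<otimes>\<^sub>r K_rep \<tau>) + (K_rep \<tau> \<otimes>\<^sub>r 1) - (K_rep \<tau> \<otimes>\<^sub>r K_rep \<tau>))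
       * ((1 \<otimes>\<^sub>r 1) + gauss \<tau> 0 2 \<bullet> (E_rep \<otimes>\<^sub>r F_rep))"

definition R01_rep :: "int \<Rightarrow> cyc comb comb"
  where "R01_rep \<tau> = ((1 \<otimes>\<^sub>r 1) - gauss \<tau> 0 1 \<bullet> (1 \<otimes>\<^sub>r K_rep \<tau>) + (K_rep \<tau> \<otimes>\<^sub>r 1)
       + gauss \<tau> 0 1 \<bullet> (K_rep \<tau> \<otimes>\<^sub>r K_rep \<tau>))
       * ((1 \<otimes>\<^sub>r 1) + gauss \<tau> 1 (-1) \<bullet> (F_rep * K_rep \<tau> \<otimes>\<^sub>r E_rep * K_rep \<tau>)
       - gauss \<tau> 1 (-1) \<bullet> (E_rep \<otimes>\<^sub>r F_rep) + gauss \<tau> 1 1 \<bullet> (E_rep * F_rep * K_rep \<tau> \<otimes>\<^sub>r 1)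
       + gauss \<tau> 0 2 \<bullet> (E_rep * F_rep * K_rep \<tau> \<otimes>\<^sub>r E_rep * F_rep * K_rep \<tau>))"

definition R10_rep :: "int \<Rightarrow> cyc comb comb"
  where "R10_rep \<tau> = ((1 \<otimes>\<^sub>r 1) + (1 \<otimes>\<^sub>r K_rep \<tau>) - gauss \<tau> 0 1 \<bullet> (K_rep \<tau> \<otimes>\<^sub>r 1)
       + gauss \<tau> 0 1 \<bullet> (K_rep \<tau> \<otimes>\<^sub>r K_rep \<tau>))
       * ((1 \<otimes>\<^sub>r K_rep \<tau>) + gauss \<tau> 1 (-1) \<bullet> (F_rep * K_rep \<tau> \<otimes>\<^sub>r E_rep)
       + gauss \<tau> 1 (-1) \<bullet> (E_rep \<otimes>\<^sub>r F_rep * K_rep \<tau>) - gauss \<tau> 1 (-1) \<bullet> (1 \<otimes>\<^sub>r E_rep * F_rep)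
       - gauss \<tau> 0 2 \<bullet> (E_rep * F_rep * K_rep \<tau> \<otimes>\<^sub>r E_rep * F_rep))"

definition R11_rep :: "int \<Rightarrow> cyc comb comb"
  where "R11_rep \<tau> = Cyc 0 1 0 0 \<bullet> ((1 \<otimes>\<^sub>r 1) - gauss \<tau> 0 1 \<bullet> (1 \<otimes>\<^sub>r K_rep \<tau>) - gauss \<tau> 0 1 \<bullet> (K_rep \<tau> \<otimes>\<^sub>r 1)
       + (K_rep \<tau> \<otimes>\<^sub>r K_rep \<tau>))
       * (gauss \<tau> 0 (-1) \<bullet> (K_rep \<tau> \<otimes>\<^sub>r 1) + gauss \<tau> 0 2 \<bullet> (E_rep * K_rep \<tau> \<otimes>\<^sub>r F_rep)
       + gauss \<tau> 1 (-1) \<bullet> (K_rep \<tau> \<otimes>\<^sub>r E_rep * F_rep * K_rep \<tau>) - gauss \<tau> 1 1 \<bullet> (E_rep * F_rep \<otimes>\<^sub>r 1)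
       - gauss \<tau> 0 2 \<bullet> (E_rep * F_rep \<otimes>\<^sub>r E_rep * F_rep * K_rep \<tau>))"

definition R_matrix_rep :: "int \<Rightarrow> cyc comb comb"
  where "R_matrix_rep \<tau> = R00_rep \<tau> * (e0_rep \<otimes>\<^sub>r e0_rep) + R01_rep \<tau> * (e0_rep \<otimes>\<^sub>r e1_rep)
       + R10_rep \<tau> * (e1_rep \<otimes>\<^sub>r e0_rep) + R11_rep \<tau> * (e1_rep \<otimes>\<^sub>r e1_rep)"

text \<open>In this sector the coassociator is \<open>1 + N + N\<^sup>2 / 2\<close>, the exponential
  of a nilpotent \<open>N\<close> with \<open>N ^ 3 = 0\<close>. The inverse is obtained by
  replacing \<open>N\<close> with \<open>- N\<close>, which changes only the two middle
  signs.\<close>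

definition Phi010_inv_rep :: "int \<Rightarrow> cyc comb comb comb"
  where "Phi010_inv_rep \<tau> =
       (1 \<otimes>\<^sub>r 1 \<otimes>\<^sub>r 1) + gauss \<tau> 1 1 \<bullet> (E_rep \<otimes>\<^sub>r K_rep \<tau> \<otimes>\<^sub>r F_rep)
       - gauss \<tau> 1 (-1) \<bullet> (F_rep * K_rep \<tau> \<otimes>\<^sub>r K_rep \<tau> \<otimes>\<^sub>r E_rep * K_rep \<tau>)
       + gauss \<tau> 2 0 \<bullet> (E_rep * F_rep * K_rep \<tau> \<otimes>\<^sub>r 1 \<otimes>\<^sub>r E_rep * F_rep * K_rep \<tau>)"

text \<open>The prefactor is \<plusminus>1, hence its own inverse, and appears unchanged.\<close>

definition Phi111_inv_rep :: "int \<Rightarrow> cyc comb comb comb"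
  where "Phi111_inv_rep \<tau> = gauss \<tau> (- \<tau>) 0 \<bullet>
      (gauss \<tau> 1 (-1) \<bullet> (1 \<otimes>\<^sub>r F_rep \<otimes>\<^sub>r E_rep * K_rep \<tau>) + (1 \<otimes>\<^sub>r K_rep \<tau> \<otimes>\<^sub>r 1)
       - gauss \<tau> 2 0 \<bullet> (1 \<otimes>\<^sub>r E_rep * F_rep \<otimes>\<^sub>r 1)
       - gauss \<tau> 0 2 \<bullet> (1 \<otimes>\<^sub>r E_rep * F_rep \<otimes>\<^sub>r E_rep * F_rep * K_rep \<tau>)
       + gauss \<tau> 1 (-1) \<bullet> (1 \<otimes>\<^sub>r E_rep * K_rep \<tau> \<otimes>\<^sub>r F_rep)
       - gauss \<tau> 1 (-1) \<bullet> (E_rep \<otimes>\<^sub>r 1 \<otimes>\<^sub>r F_rep)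
       + gauss \<tau> 1 (-1) \<bullet> (E_rep \<otimes>\<^sub>r F_rep * K_rep \<tau> \<otimes>\<^sub>r 1)
       + gauss \<tau> 0 2 \<bullet> (E_rep \<otimes>\<^sub>r F_rep * K_rep \<tau> \<otimes>\<^sub>r E_rep * F_rep * K_rep \<tau>)
       - gauss \<tau> 2 0 \<bullet> (E_rep \<otimes>\<^sub>r E_rep * F_rep * K_rep \<tau> \<otimes>\<^sub>r F_rep)
       - gauss \<tau> 1 (-1) \<bullet> (F_rep * K_rep \<tau> \<otimes>\<^sub>r 1 \<otimes>\<^sub>r E_rep * K_rep \<tau>)
       + gauss \<tau> 1 (-1) \<bullet> (F_rep * K_rep \<tau> \<otimes>\<^sub>r E_rep \<otimes>\<^sub>r 1)
       + gauss \<tau> 0 2 \<bullet> (F_rep * K_rep \<tau> \<otimes>\<^sub>r E_rep \<otimes>\<^sub>r E_rep * F_rep * K_rep \<tau>)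
       - gauss \<tau> 2 0 \<bullet> (F_rep * K_rep \<tau> \<otimes>\<^sub>r E_rep * F_rep * K_rep \<tau> \<otimes>\<^sub>r E_rep * K_rep \<tau>)
       + gauss \<tau> 0 2 \<bullet> (E_rep * F_rep * K_rep \<tau> \<otimes>\<^sub>r F_rep \<otimes>\<^sub>r E_rep * K_rep \<tau>)
       + gauss \<tau> 0 2 \<bullet> (E_rep * F_rep * K_rep \<tau> \<otimes>\<^sub>r K_rep \<tau> \<otimes>\<^sub>r E_rep * F_rep * K_rep \<tau>)
       - gauss \<tau> 0 2 \<bullet> (E_rep * F_rep * K_rep \<tau> \<otimes>\<^sub>r E_rep * F_rep \<otimes>\<^sub>r 1)
       + gauss \<tau> 0 2 \<bullet> (E_rep * F_rep * K_rep \<tau> \<otimes>\<^sub>r E_rep * K_rep \<tau> \<otimes>\<^sub>r F_rep)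
       + gauss \<tau> 4 0 \<bullet> (E_rep * F_rep * K_rep \<tau> \<otimes>\<^sub>r E_rep * F_rep \<otimes>\<^sub>r E_rep * F_rep * K_rep \<tau>))"

definition Phi_inv_rep :: "int \<Rightarrow> cyc comb comb comb"
  where "Phi_inv_rep \<tau> = (e0_rep \<otimes>\<^sub>r e0_rep \<otimes>\<^sub>r e0_rep) + (e1_rep \<otimes>\<^sub>r e0_rep \<otimes>\<^sub>r e0_rep)
       + Phi010_inv_rep \<tau> * (e0_rep \<otimes>\<^sub>r e1_rep \<otimes>\<^sub>r e0_rep)
       + (e0_rep \<otimes>\<^sub>r e0_rep \<otimes>\<^sub>r e1_rep) + (e1_rep \<otimes>\<^sub>r e1_rep \<otimes>\<^sub>r e0_rep)
       + Phi101_rep \<tau> * (e1_rep \<otimes>\<^sub>r e0_rep \<otimes>\<^sub>r e1_rep)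
       + (e0_rep \<otimes>\<^sub>r e1_rep \<otimes>\<^sub>r e1_rep)
       + Phi111_inv_rep \<tau> * (e1_rep \<otimes>\<^sub>r e1_rep \<otimes>\<^sub>r e1_rep)"

text \<open>In each sector \<open>2 R\<close> is, up to a scalar, a product \<open>P * B\<close>
  with \<open>P\<close> built from \<open>K\<close> and \<open>P\<^sup>2 = 4\<close>. Therefore
  \<open>2 R\<^sup>-\<^sup>1\<close> is the inverse of \<open>B\<close> followed by
  \<open>P\<close>, in this order.\<close>

definition R00_inv_rep :: "int \<Rightarrow> cyc comb comb"
  where "R00_inv_rep \<tau> = ((1 \<otimes>\<^sub>r 1) - gauss \<tau> 0 2 \<bullet> (E_rep \<otimes>\<^sub>r F_rep))
       * ((1 \<otimes>\<^sub>r 1) + (1 \<otimes>\<^sub>r K_rep \<tau>) + (K_rep \<tau> \<otimes>\<^sub>r 1) - (K_rep \<tau> \<otimes>\<^sub>r K_rep \<tau>))"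

definition R01_inv_rep :: "int \<Rightarrow> cyc comb comb"
  where "R01_inv_rep \<tau> = ((1 \<otimes>\<^sub>r 1) - gauss \<tau> 1 (-1) \<bullet> (F_rep * K_rep \<tau> \<otimes>\<^sub>r E_rep * K_rep \<tau>)
       + gauss \<tau> 1 (-1) \<bullet> (E_rep \<otimes>\<^sub>r F_rep) + gauss \<tau> 1 (-1) \<bullet> (E_rep * F_rep * K_rep \<tau> \<otimes>\<^sub>r 1)
       + gauss \<tau> 0 2 \<bullet> (E_rep * F_rep * K_rep \<tau> \<otimes>\<^sub>r E_rep * F_rep * K_rep \<tau>))
       * ((1 \<otimes>\<^sub>r 1) - gauss \<tau> 0 1 \<bullet> (1 \<otimes>\<^sub>r K_rep \<tau>) + (K_rep \<tau> \<otimes>\<^sub>r 1)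
       + gauss \<tau> 0 1 \<bullet> (K_rep \<tau> \<otimes>\<^sub>r K_rep \<tau>))"

definition R10_inv_rep :: "int \<Rightarrow> cyc comb comb"
  where "R10_inv_rep \<tau> = ((1 \<otimes>\<^sub>r K_rep \<tau>) + gauss \<tau> 1 (-1) \<bullet> (F_rep * K_rep \<tau> \<otimes>\<^sub>r E_rep)
       + gauss \<tau> 1 (-1) \<bullet> (E_rep \<otimes>\<^sub>r F_rep * K_rep \<tau>) - gauss \<tau> 1 1 \<bullet> (1 \<otimes>\<^sub>r E_rep * F_rep)
       - gauss \<tau> 0 2 \<bullet> (E_rep * F_rep * K_rep \<tau> \<otimes>\<^sub>r E_rep * F_rep))
       * ((1 \<otimes>\<^sub>r 1) + (1 \<otimes>\<^sub>r K_rep \<tau>) - gauss \<tau> 0 1 \<bullet> (K_rep \<tau> \<otimes>\<^sub>r 1)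
       + gauss \<tau> 0 1 \<bullet> (K_rep \<tau> \<otimes>\<^sub>r K_rep \<tau>))"

text \<open>The scalar \<open>Cyc 0 0 0 (-1)\<close> is -\<beta>^3, the inverse of \<beta>.\<close>

definition R11_inv_rep :: "int \<Rightarrow> cyc comb comb"
  where "R11_inv_rep \<tau> = Cyc 0 0 0 (-1) \<bullet> (gauss \<tau> 0 (-1) \<bullet> (K_rep \<tau> \<otimes>\<^sub>r 1) + gauss \<tau> 0 2 \<bullet> (E_rep * K_rep \<tau> \<otimes>\<^sub>r F_rep)
       + gauss \<tau> 1 1 \<bullet> (K_rep \<tau> \<otimes>\<^sub>r E_rep * F_rep * K_rep \<tau>) - gauss \<tau> 1 (-1) \<bullet> (E_rep * F_rep \<otimes>\<^sub>r 1)
       - gauss \<tau> 0 2 \<bullet> (E_rep * F_rep \<otimes>\<^sub>r E_rep * F_rep * K_rep \<tau>))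
       * ((1 \<otimes>\<^sub>r 1) - gauss \<tau> 0 1 \<bullet> (1 \<otimes>\<^sub>r K_rep \<tau>) - gauss \<tau> 0 1 \<bullet> (K_rep \<tau> \<otimes>\<^sub>r 1)
       + (K_rep \<tau> \<otimes>\<^sub>r K_rep \<tau>))"

definition R_matrix_inv_rep :: "int \<Rightarrow> cyc comb comb"
  where "R_matrix_inv_rep \<tau> = R00_inv_rep \<tau> * (e0_rep \<otimes>\<^sub>r e0_rep) + R01_inv_rep \<tau> * (e0_rep \<otimes>\<^sub>r e1_rep)
       + R10_inv_rep \<tau> * (e1_rep \<otimes>\<^sub>r e0_rep) + R11_inv_rep \<tau> * (e1_rep \<otimes>\<^sub>r e1_rep)"

definition mono_rep :: "mono \<Rightarrow> cyc comb" where "mono_rep m = Comb [(m, 1)]"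

definition linear1 :: "(mono \<Rightarrow> 's::rep) \<Rightarrow> cyc comb \<Rightarrow> 's"
  where "linear1 f = linear_comb (\<lambda>m c. c \<bullet> f m)"
definition linear2 :: "(mono \<Rightarrow> mono \<Rightarrow> 's::rep) \<Rightarrow> cyc comb comb \<Rightarrow> 's"
  where "linear2 f = linear_comb (\<lambda>m. linear1 (f m))"
definition linear3 :: "(mono \<Rightarrow> mono \<Rightarrow> mono \<Rightarrow> 's::rep) \<Rightarrow> cyc comb comb comb \<Rightarrow> 's"
  where "linear3 f = linear_comb (\<lambda>m. linear2 (f m))"

definition Delta_rep :: "int \<Rightarrow> cyc comb \<Rightarrow> cyc comb comb"
  where "Delta_rep \<tau> = linear1 (Delta_mono \<tau>)"
text \<open>The rest \<open>x\<close> is attached to the second leg of the coproduct, so the result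
  is already nested to the right: \<open>tensor_assoc\<close> is built in.\<close>

definition Delta_id_rep :: "int \<Rightarrow> 'r::rep comb \<Rightarrow> 'r comb comb"
  where "Delta_id_rep \<tau> = linear_comb (\<lambda>m x. map_coeffs (\<lambda>q. q \<otimes>\<^sub>r x) (Delta_mono \<tau> m))"

definition leg_21_rep :: "cyc comb comb \<Rightarrow> cyc comb comb"
  where "leg_21_rep = linear2 (\<lambda>x y. mono_rep y \<otimes>\<^sub>r mono_rep x)"
definition leg_132_rep :: "cyc comb comb comb \<Rightarrow> cyc comb comb comb"
  where "leg_132_rep = linear3 (\<lambda>x y z. mono_rep x \<otimes>\<^sub>r mono_rep z \<otimes>\<^sub>r mono_rep y)"
definition leg_213_rep :: "cyc comb comb comb \<Rightarrow> cyc comb comb comb"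
  where "leg_213_rep = linear3 (\<lambda>x y z. mono_rep y \<otimes>\<^sub>r mono_rep x \<otimes>\<^sub>r mono_rep z)"
definition leg_231_rep :: "cyc comb comb comb \<Rightarrow> cyc comb comb comb"
  where "leg_231_rep = linear3 (\<lambda>x y z. mono_rep y \<otimes>\<^sub>r mono_rep z \<otimes>\<^sub>r mono_rep x)"
definition leg_312_rep :: "cyc comb comb comb \<Rightarrow> cyc comb comb comb"
  where "leg_312_rep = linear3 (\<lambda>x y z. mono_rep z \<otimes>\<^sub>r mono_rep x \<otimes>\<^sub>r mono_rep y)"
definition in_12_rep :: "cyc comb comb \<Rightarrow> cyc comb comb comb"
  where "in_12_rep = linear2 (\<lambda>x y. mono_rep x \<otimes>\<^sub>r mono_rep y \<otimes>\<^sub>r 1)"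
definition in_13_rep :: "cyc comb comb \<Rightarrow> cyc comb comb comb"
  where "in_13_rep = linear2 (\<lambda>x y. mono_rep x \<otimes>\<^sub>r 1 \<otimes>\<^sub>r mono_rep y)"
definition in_123_rep :: "cyc comb comb comb \<Rightarrow> cyc comb comb comb comb"
  where "in_123_rep = linear3 (\<lambda>x y z. mono_rep x \<otimes>\<^sub>r mono_rep y \<otimes>\<^sub>r mono_rep z \<otimes>\<^sub>r 1)"

section \<open>Agreement of the structure maps with their representatives\<close>

context Q_coefficients
begin

lemma clinear_Delta: "clinear Delta"
  using algebra_hom_Delta by (simp add: algebra_hom_def)

lemma Delta_simps: "Delta 1 = 1" "Delta (x * y) = Delta x * Delta y" "Delta (x + y) = Delta x + Delta y"
  "Delta (x - y) = Delta x - Delta y" "Delta (- x) = - Delta x" "Delta (c *\<^sub>C x) = c *\<^sub>C Delta x"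
  using algebra_hom_Delta
  by (simp_all add: algebra_hom_def clinear_add clinear_diff clinear_uminus clinear_scale)

lemma S_simps: "S 1 = 1" "S (x * y) = S y * S x" "S (x + y) = S x + S y"
  "S (x - y) = S x - S y" "S (- x) = - S x" "S (c *\<^sub>C x) = c *\<^sub>C S x"
  using algebra_antihom_S
  by (simp_all add: algebra_antihom_def clinear_add clinear_diff clinear_uminus clinear_scale)

lemma epsilon_simps: "epsilon 1 = 1" "epsilon (x * y) = epsilon x * epsilon y" "epsilon (x + y) = epsilon x + epsilon y"
  "epsilon (x - y) = epsilon x - epsilon y" "epsilon (- x) = - epsilon x" "epsilon (c *\<^sub>C x) = c * epsilon x"
  using algebra_hom_epsilon
  by (simp_all add: algebra_hom_def clinear_add clinear_diff clinear_uminus clinear_scale)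
    (simp add: scaleC_complex_def)

lemma epsilon_mono: "epsilon (mono_val m) = (if epsilon_mono m then 1 else 0)"
proof -
  have "epsilon e\<^sub>0 = 1" "epsilon e\<^sub>1 = 0"
    by (simp_all add: idem0_def idem1_def power2_eq_square epsilon_simps epsilon_generators)
  then show ?thesis
    by (cases m) (simp add: kappa_def epsilon_simps epsilon_generators)
qed

text \<open>Next to an idempotent, \<kappa> is a multiple of \<open>K\<close>, on which the values
  of the structure maps are known.\<close>

lemma kappa_val:
  "(if k then \<kappa> else 1) * (if s then e\<^sub>1 else e\<^sub>0) =
    (if k then (if s then - \<i> else 1) *\<^sub>C K else 1) * (if s then e\<^sub>1 else e\<^sub>0)"
  by (simp add: kappa_idem)

lemma S_mono: "S (mono_val m) = val1 (S_mono \<tau> m)"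
proof -
  have "Kinv * Kinv = K * K" by (simp add: Kinv_K mult.assoc K4_assoc)
  then have "S e\<^sub>0 = e\<^sub>0" "S e\<^sub>1 = e\<^sub>1"
    by (simp_all add: idem0_def idem1_def power2_eq_square S_simps S_generators)
  then show ?thesis
    by (cases m) (simp add: kappa_val S_simps S_generators generator_vals mult.assoc
        del: comb_val.simps)
qed

text \<open>The element \<open>K * K = e\<^sub>0 - e\<^sub>1\<close> is grouplike, so its coproduct
  expands into the four products of idempotents with signs.\<close>

lemma Delta_idem: "Delta e\<^sub>0 = (e\<^sub>0 \<otimes> e\<^sub>0) + (e\<^sub>1 \<otimes> e\<^sub>1)" "Delta e\<^sub>1 = (e\<^sub>0 \<otimes> e\<^sub>1) + (e\<^sub>1 \<otimes> e\<^sub>0)"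
proof -
  have K2: "K * K = e\<^sub>0 - e\<^sub>1"
    using split_idem[of "K * K"] by (simp add: mult.assoc K_idem)
  have one: "1 = e\<^sub>0 + e\<^sub>1" by (simp add: idem_sum)
  have D: "Delta e\<^sub>0 = (1/2) *\<^sub>C ((1 \<otimes> 1) + (K * K \<otimes> K * K))" "Delta e\<^sub>1 = (1/2) *\<^sub>C ((1 \<otimes> 1) - (K * K \<otimes> K * K))"
    by (simp_all add: idem0_def idem1_def power2_eq_square Delta_simps
        Delta_generators one_tensor)
  have ten: "(1 \<otimes> 1) + (K * K \<otimes> K * K) = ((e\<^sub>0 \<otimes> e\<^sub>0) + (e\<^sub>1 \<otimes> e\<^sub>1)) + ((e\<^sub>0 \<otimes> e\<^sub>0) + (e\<^sub>1 \<otimes> e\<^sub>1))"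
    "(1 \<otimes> 1) - (K * K \<otimes> K * K) = ((e\<^sub>0 \<otimes> e\<^sub>1) + (e\<^sub>1 \<otimes> e\<^sub>0)) + ((e\<^sub>0 \<otimes> e\<^sub>1) + (e\<^sub>1 \<otimes> e\<^sub>0))"
    by (simp_all only: K2 one pure_tensor_add_left pure_tensor_add_right pure_tensor_diff) simp_all
  show "Delta e\<^sub>0 = (e\<^sub>0 \<otimes> e\<^sub>0) + (e\<^sub>1 \<otimes> e\<^sub>1)" "Delta e\<^sub>1 = (e\<^sub>0 \<otimes> e\<^sub>1) + (e\<^sub>1 \<otimes> e\<^sub>0)"
    unfolding D ten scaleC_half_double by (rule refl)+
qed

lemma Delta_mono: "Delta (mono_val m) = val2 (Delta_mono \<tau> m)"
proof -
  show ?thesis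
    by (cases m) (simp add: kappa_val Delta_simps Delta_generators Delta_idem generator_vals
        tensor_vals mult.assoc del: comb_val.simps)
qed

lemma mono_rep [simp]: "val1 (mono_rep m) = mono_val m"
  by (simp add: mono_rep_def del: cyc_val.simps)

lemma linear1:
  assumes "representation \<beta> ev" "clinear T" "\<And>m. T (mono_val m) = ev (f m)"
  shows "T (val1 p) = ev (linear1 f p)"
  unfolding linear1_def
proof (rule linear_comb[OF assms(1,2)])
  show "T (val0 c *\<^sub>C mono_val m) = ev (c \<bullet> f m)" for m c
    by (simp only: clinear_scale[OF assms(2)] assms(3) representation.ev_scl[OF assms(1)])
qed

text \<open>With the monomial of the first leg fixed, \<open>T\<close> is linear in the second, and
  \<open>linear1\<close> applies there.\<close>

lemma linear2:
  assumes "representation \<beta> ev" "clinear T" "\<And>m n. T (mono_val m \<otimes> mono_val n) = ev (f m n)"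
  shows "T (val2 p) = ev (linear2 f p)"
  unfolding linear2_def
proof (rule linear_comb[OF assms(1,2)])
  show "T (mono_val m \<otimes> val1 x) = ev (linear1 (f m) x)" for m x
    by (rule linear1[OF assms(1), of "\<lambda>y. T (mono_val m \<otimes> y)"])
      (simp_all add: assms(3) clinear_iff clinear_add[OF assms(2)] clinear_scale[OF assms(2)]
        pure_tensor_add_right pure_tensor_scaleC_right)
qed

lemma linear3:
  assumes "representation \<beta> ev" "clinear T"
    and "\<And>m n l. T (mono_val m \<otimes> mono_val n \<otimes> mono_val l) = ev (f m n l)"
  shows "T (val3 p) = ev (linear3 f p)"
  unfolding linear3_def
proof (rule linear_comb[OF assms(1,2)])
  show "T (mono_val m \<otimes> val2 x) = ev (linear2 (f m) x)" for m x
    by (rule linear2[OF assms(1), of "\<lambda>y. T (mono_val m \<otimes> y)"])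
      (simp_all add: assms(3) clinear_iff clinear_add[OF assms(2)] clinear_scale[OF assms(2)]
        pure_tensor_add_right pure_tensor_scaleC_right)
qed

lemma Delta_val: "Delta (val1 p) = val2 (Delta_rep \<tau> p)"
  unfolding Delta_rep_def
  by (rule linear1[OF t3.representation_axioms]) (use algebra_hom_Delta Delta_mono in \<open>auto simp: algebra_hom_def\<close>)

lemma clinear_id: "clinear (id :: 'a::complex_algebra \<Rightarrow> 'a)"
  by (simp add: clinear_iff)

lemma clinear_comp: "clinear f \<Longrightarrow> clinear g \<Longrightarrow> clinear (\<lambda>x. f (g x))"
  by (simp add: clinear_iff)

text \<open>The number of further legs is left open in order to serve both quasi-coassociativity and
  the pentagon. The map \<open>g\<close> is \<open>id\<close> or
  \<open>id \<otimes>\<^sub>m id\<close>; the latter is only known to fix evaluated representatives,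
  whence the form of the assumption.\<close>

lemma Delta_id_val:
  assumes "tensor_step \<beta> ev ((\<otimes>) :: Q \<Rightarrow> 'a \<Rightarrow> (Q, 'a) tensor)" "clinear g" "\<And>x. g (ev x) = ev x"
  shows "tensor_assoc ((Delta \<otimes>\<^sub>m g) (comb_val (\<otimes>) ev p))
    = comb_val (\<otimes>) (comb_val (\<otimes>) (ev :: 'r::rep \<Rightarrow> 'a::complex_algebra)) (Delta_id_rep \<tau> p)"
proof -
  interpret t: tensor_step \<beta> ev "(\<otimes>) :: Q \<Rightarrow> 'a \<Rightarrow> _" by fact
  interpret t': representation \<beta> "comb_val (\<otimes>) ev :: _ \<Rightarrow> (Q, 'a) tensor" by (rule t.representation_comb)
  interpret t'': tensor_step \<beta> "comb_val (\<otimes>) ev" "(\<otimes>) :: Q \<Rightarrow> (Q, 'a) tensor \<Rightarrow> _"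
    by unfold_locales (simp_all add: cbilinear_pure_tensor one_tensor)
  show ?thesis unfolding Delta_id_rep_def
  proof (rule linear_comb[OF t''.representation_comb])
    show "clinear (\<lambda>t. tensor_assoc ((Delta \<otimes>\<^sub>m g) t))"
      by (rule clinear_comp[OF clinear_tensor_assoc clinear_tensor_map[OF clinear_Delta assms(2)]])
    fix m x
    have "tensor_assoc ((Delta \<otimes>\<^sub>m g) (mono_val m \<otimes> ev x)) = tensor_assoc (val2 (Delta_mono \<tau> m) \<otimes> ev x)"
      by (simp only: tensor_map_pure[OF clinear_Delta assms(2)] assms(3) Delta_mono)
    also have "\<dots> = comb_val (\<otimes>) (comb_val (\<otimes>) ev) (map_coeffs (\<lambda>q. q \<otimes>\<^sub>r x) (Delta_mono \<tau> m))"
    proof (rule map_coeffs[of "\<lambda>t. tensor_assoc (t \<otimes> ev x)"])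
      show "clinear (\<lambda>t. tensor_assoc (t \<otimes> ev x))"
        by (intro clinearI) (simp_all only: pure_tensor_add_left pure_tensor_scaleC_left
            clinear_add[OF clinear_tensor_assoc] clinear_scale[OF clinear_tensor_assoc])
    qed (simp only: tensor_assoc_pure t.tensor_rep)
    finally show "tensor_assoc ((Delta \<otimes>\<^sub>m g) (mono_val m \<otimes> ev x))
      = comb_val (\<otimes>) (comb_val (\<otimes>) ev) (map_coeffs (\<lambda>q. q \<otimes>\<^sub>r x) (Delta_mono \<tau> m))" .
  qed
qed

lemma id_tensor_val:
  fixes g :: "'a::complex_algebra \<Rightarrow> 'b::complex_algebra"
  assumes "clinear g" "\<And>x. g (ev x) = ev' (f x)"
  shows "(id \<otimes>\<^sub>m g) (comb_val (\<otimes>) ev p) = comb_val (\<otimes>) ev' (map_coeffs f p)"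
proof (rule map_coeffs)
  show "clinear (id \<otimes>\<^sub>m g :: (Q, 'a) tensor \<Rightarrow> (Q, 'b) tensor)"
    by (intro clinear_tensor_map clinear_id assms)
qed (subst tensor_map_pure[OF clinear_id assms(1)], simp add: assms(2))

lemma id_tensor_id: "(id \<otimes>\<^sub>m id) (comb_val (\<otimes>) ev p) = comb_val (\<otimes>) (ev :: 'r \<Rightarrow> 'a::complex_algebra) p"
proof (cases p)
  case (Comb xs)
  have id: "clinear (id \<otimes>\<^sub>m id :: (Q, 'a) tensor \<Rightarrow> _)" by (intro clinear_tensor_map clinear_id)
  show ?thesis unfolding Comb
    by (induction xs) (auto simp: clinear_0[OF id] clinear_add[OF id] tensor_map_pure clinear_id simp del: id_apply, simp)
qed

lemmas pure_tensor_linear = pure_tensor_add_left pure_tensor_add_right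
  pure_tensor_scaleC_left pure_tensor_scaleC_right

lemma tensor_lift_val:
  assumes "representation \<beta> ev" "cbilinear g" "\<And>m n. g (mono_val m) (mono_val n) = ev (f m n)"
  shows "tensor_lift g (val2 p) = ev (linear2 f p)"
  by (rule linear2) (simp_all add: assms clinear_tensor_lift tensor_lift_pure)

lemma tensor_lift3_val:
  assumes "representation \<beta> ev" "\<And>x. cbilinear (g x)" "\<And>y z. clinear (\<lambda>x. g x y z)"
    and "\<And>m n l. g (mono_val m) (mono_val n) (mono_val l) = ev (f m n l)"
  shows "tensor_lift3 g (val3 p) = ev (linear3 f p)"
proof (rule linear3[OF assms(1)])
  show "clinear (tensor_lift3 g)"
    unfolding tensor_lift3_def by (intro clinear_tensor_lift cbilinear_tensor_lift3 assms)
qed (simp add: tensor_lift3_pure assms)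

lemmas lift_simps = cbilinear_def clinear_iff pure_tensor_linear tensor_vals one_tensor

lemma leg_vals:
  "leg_21 (val2 p) = val2 (leg_21_rep p)"
  "in_12 (val2 p) = val3 (in_12_rep p)" "in_13 (val2 p) = val3 (in_13_rep p)"
  unfolding leg_21_def leg_21_rep_def in_12_def in_12_rep_def in_13_def in_13_rep_def
  by (rule tensor_lift_val[OF t3.representation_axioms] tensor_lift_val[OF t4.representation_axioms],
      simp_all add: lift_simps del: comb_val.simps)+

lemma leg_vals3:
  "leg_132 (val3 q) = val3 (leg_132_rep q)" "leg_213 (val3 q) = val3 (leg_213_rep q)"
  "leg_231 (val3 q) = val3 (leg_231_rep q)" "leg_312 (val3 q) = val3 (leg_312_rep q)"
  "in_123 (val3 q) = val4 (in_123_rep q)"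
  unfolding leg_132_def leg_132_rep_def leg_213_def leg_213_rep_def leg_231_def leg_231_rep_def
    leg_312_def leg_312_rep_def in_123_def in_123_rep_def
  by (rule tensor_lift3_val[OF t4.representation_axioms] tensor_lift3_val[OF r4.representation_axioms],
      simp_all add: lift_simps del: comb_val.simps)+

lemma in_vals: "in_23 (val2 p) = val3 (1 \<otimes>\<^sub>r p)" "in_234 (val3 q) = val4 (1 \<otimes>\<^sub>r q)"
  by (simp_all add: in_23_def in_234_def tensor_vals del: comb_val.simps)

lemma scalar_vals:
  "val0 (gauss \<tau> 1 1) = 1 + \<i>" "val0 (gauss \<tau> 1 (-1)) = 1 - \<i>" "val0 (gauss \<tau> (-1) 1) = \<i> - 1"
  "val0 (gauss \<tau> 0 1) = \<i>" "val0 (gauss \<tau> 0 (-1)) = - \<i>" "val0 (gauss \<tau> 0 2) = 2 * \<i>"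
  "val0 (gauss \<tau> 2 0) = 2" "val0 (gauss \<tau> 4 0) = 4" "val0 (gauss \<tau> (- \<tau>) 0) = \<i> * \<beta>\<^sup>2"
  "val0 (Cyc 0 1 0 0) = \<beta>"
proof -
  have "\<beta>\<^sup>2 * \<beta>\<^sup>2 = -1" using \<beta>4 by (simp flip: power_add)
  then have "\<i> * \<beta>\<^sup>2 = - of_int \<tau>" by (subst i_eq, simp only: mult.assoc) simp
  then show "val0 (gauss \<tau> (- \<tau>) 0) = \<i> * \<beta>\<^sup>2" by (simp only: gauss_val) simp
qed (simp_all)

lemmas rep_vals = scalar_vals generator_vals tensor_vals t2.ev_1
  t2.ev_mult t3.ev_add t3.ev_diff t3.ev_mult t3.ev_scl t4.ev_add t4.ev_diff t4.ev_mult t4.ev_scl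

lemma Phi_val: "val3 (Phi_rep \<tau>) = Phi \<beta>"
  by (simp only: Phi_rep_def Phi_def Phi010_rep_def Phi010_def Phi101_rep_def Phi101_def
      Phi111_rep_def Phi111_def rep_vals)

lemma R_matrix_val: "val2 (R_matrix_rep \<tau>) = 2 *\<^sub>C R_matrix \<beta>"
proof -
  have half: "2 *\<^sub>C (((1/2) *\<^sub>C x) * y) = x * y" "2 *\<^sub>C (((\<beta>/2) *\<^sub>C x) * y) = \<beta> *\<^sub>C x * y" for x y :: "Q tensor2"
    by simp_all
  have "2 *\<^sub>C R00 = val2 (R00_rep \<tau>)" "2 *\<^sub>C R01 = val2 (R01_rep \<tau>)"
    "2 *\<^sub>C R10 = val2 (R10_rep \<tau>)" "2 *\<^sub>C R11 \<beta> = val2 (R11_rep \<tau>)"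
    by (simp_all only: R00_rep_def R00_def R01_rep_def R01_def R10_rep_def R10_def R11_rep_def R11_def
        rep_vals half)
  then show ?thesis
    by (simp only: R_matrix_rep_def R_matrix_def rep_vals scaleC_add_right mult_scaleC_left[symmetric])
qed

end

section \<open>The axioms as finite calculations\<close>

text \<open>In the sector of \<open>e\<^sub>1\<close> one has \<open>K - Kinv = 2 K\<close>, so
  twice the Casimir element is \<open>2 F E - \<i> K\<close>. Absorbing the factor 2 keeps the
  coefficients integral.\<close>

definition coevaluation_rep :: "int \<Rightarrow> cyc comb"
  where "coevaluation_rep \<tau> = e0_rep
    - gauss \<tau> (- \<tau>) 0 \<bullet> ((gauss \<tau> 2 0 \<bullet> (F_rep * E_rep) - gauss \<tau> 0 1 \<bullet> K_rep \<tau>) * e1_rep)"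

definition counit_left_rep :: "cyc comb comb \<Rightarrow> cyc comb"
  where "counit_left_rep = linear2 (\<lambda>x y. if epsilon_mono x then mono_rep y else 0)"
definition counit_right_rep :: "cyc comb comb \<Rightarrow> cyc comb"
  where "counit_right_rep = linear2 (\<lambda>x y. if epsilon_mono y then mono_rep x else 0)"
definition counit_middle_rep :: "cyc comb comb comb \<Rightarrow> cyc comb comb"
  where "counit_middle_rep = linear3 (\<lambda>x y z. if epsilon_mono y then mono_rep x \<otimes>\<^sub>r mono_rep z else 0)"
definition antipode_ev_rep :: "int \<Rightarrow> cyc comb comb \<Rightarrow> cyc comb"
  where "antipode_ev_rep \<tau> = linear2 (\<lambda>x y. S_mono \<tau> x * mono_rep y)"
definition antipode_coev_rep :: "int \<Rightarrow> cyc comb comb \<Rightarrow> cyc comb"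
  where "antipode_coev_rep \<tau> = linear2 (\<lambda>x y. mono_rep x * coevaluation_rep \<tau> * S_mono \<tau> y)"
definition zigzag_rep :: "int \<Rightarrow> cyc comb comb comb \<Rightarrow> cyc comb"
  where "zigzag_rep \<tau> = linear3 (\<lambda>x y z. S_mono \<tau> x * mono_rep y * coevaluation_rep \<tau> * S_mono \<tau> z)"
definition zigzag_inverse_rep :: "int \<Rightarrow> cyc comb comb comb \<Rightarrow> cyc comb"
  where "zigzag_inverse_rep \<tau> = linear3 (\<lambda>x y z. mono_rep x * coevaluation_rep \<tau> * S_mono \<tau> y * mono_rep z)"

text \<open>The coproduct is an argument so that it can be computed once for all six tests.
  Quasi-coassociativity is tested after multiplication by \<Phi> on the right, which avoids the
  inverse.\<close>

definition coproduct_check :: "int \<Rightarrow> mono \<Rightarrow> cyc comb comb \<Rightarrow> bool"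
  where "coproduct_check \<tau> m d \<longleftrightarrow>
    vanishes (counit_left_rep d - mono_rep m) \<and>
    vanishes (counit_right_rep d - mono_rep m) \<and>
    vanishes (antipode_ev_rep \<tau> d - (if epsilon_mono m then 1 else 0)) \<and>
    vanishes (antipode_coev_rep \<tau> d - (if epsilon_mono m then coevaluation_rep \<tau> else 0)) \<and>
    vanishes (Delta_id_rep \<tau> d * Phi_rep \<tau> - Phi_rep \<tau> * map_coeffs (Delta_rep \<tau>) d) \<and>
    vanishes (R_matrix_rep \<tau> * d - leg_21_rep d * R_matrix_rep \<tau>)"

fun mono_check :: "int \<Rightarrow> mono \<Rightarrow> bool"
  where "mono_check \<tau> m \<longleftrightarrow> coproduct_check \<tau> m (Delta_mono \<tau> m)"

text \<open>The permuted coassociators are tested separately because the leg maps are treated only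
  as linear maps, not as homomorphisms. The value 4 in the last two tests is the product of the
  factors 2 in both representatives.\<close>

definition inverse_check :: "int \<Rightarrow> bool"
  where "inverse_check \<tau> \<longleftrightarrow>
    vanishes (Phi_rep \<tau> * Phi_inv_rep \<tau> - 1) \<and> vanishes (Phi_inv_rep \<tau> * Phi_rep \<tau> - 1) \<and>
    vanishes (leg_231_rep (Phi_rep \<tau>) * leg_231_rep (Phi_inv_rep \<tau>) - 1) \<and>
    vanishes (leg_231_rep (Phi_inv_rep \<tau>) * leg_231_rep (Phi_rep \<tau>) - 1) \<and>
    vanishes (leg_312_rep (Phi_rep \<tau>) * leg_312_rep (Phi_inv_rep \<tau>) - 1) \<and>
    vanishes (leg_213_rep (Phi_rep \<tau>) * leg_213_rep (Phi_inv_rep \<tau>) - 1) \<and>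
    vanishes (leg_213_rep (Phi_inv_rep \<tau>) * leg_213_rep (Phi_rep \<tau>) - 1) \<and>
    vanishes (R_matrix_rep \<tau> * R_matrix_inv_rep \<tau> - gauss \<tau> 4 0 \<bullet> 1) \<and>
    vanishes (R_matrix_inv_rep \<tau> * R_matrix_rep \<tau> - gauss \<tau> 4 0 \<bullet> 1)"

definition coassociator_check :: "int \<Rightarrow> bool"
  where "coassociator_check \<tau> \<longleftrightarrow>
    vanishes (counit_middle_rep (Phi_rep \<tau>) - 1) \<and>
    vanishes (zigzag_rep \<tau> (Phi_rep \<tau>) - 1) \<and> vanishes (zigzag_inverse_rep \<tau> (Phi_inv_rep \<tau>) - 1) \<and>
    vanishes (Delta_id_rep \<tau> (Phi_rep \<tau>) * map_coeffs (map_coeffs (Delta_rep \<tau>)) (Phi_rep \<tau>)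
      - in_123_rep (Phi_rep \<tau>) * map_coeffs (Delta_id_rep \<tau>) (Phi_rep \<tau>) * (1 \<otimes>\<^sub>r Phi_rep \<tau>))"

text \<open>Each hexagon has one factor \<open>R\<close> on the left and two on the right, hence the factor 2.\<close>

definition hexagon_check :: "int \<Rightarrow> bool"
  where "hexagon_check \<tau> \<longleftrightarrow>
    vanishes (gauss \<tau> 2 0 \<bullet> (leg_231_rep (Phi_rep \<tau>) * Delta_id_rep \<tau> (R_matrix_rep \<tau>) * Phi_rep \<tau>)
      - in_13_rep (R_matrix_rep \<tau>) * leg_132_rep (Phi_rep \<tau>) * (1 \<otimes>\<^sub>r R_matrix_rep \<tau>)) \<and>
    vanishes (gauss \<tau> 2 0 \<bullet> (leg_312_rep (Phi_inv_rep \<tau>) * map_coeffs (Delta_rep \<tau>) (R_matrix_rep \<tau>) * Phi_inv_rep \<tau>)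
      - in_13_rep (R_matrix_rep \<tau>) * leg_213_rep (Phi_inv_rep \<tau>) * in_12_rep (R_matrix_rep \<tau>))"

definition all_monos :: "mono list"
  where "all_monos = [Mono s a b k. s \<leftarrow> [False, True], a \<leftarrow> [False, True], b \<leftarrow> [False, True], k \<leftarrow> [False, True]]"

lemma mono_in_all_monos: "m \<in> set all_monos"
proof (cases m)
  case (Mono s a b k)
  show ?thesis unfolding Mono all_monos_def by (cases s; cases a; cases b; cases k) simp_all
qed

lemma inverse_checks: "inverse_check 1" "inverse_check (-1)"
  by code_simp+

lemma coassociator_checks: "coassociator_check 1" "coassociator_check (-1)"
  by code_simp+

lemma hexagon_checks: "hexagon_check 1" "hexagon_check (-1)"
  by code_simp+

lemma mono_checks_1: "list_all (mono_check 1) all_monos"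
  by code_simp

lemma mono_checks_minus_1: "list_all (mono_check (-1)) all_monos"
  by code_simp

lemma (in representation) ev_eqI: "vanishes (x - y) \<Longrightarrow> ev x = ev y"
  using ev_vanishes[of "x - y"] by simp

context Q_coefficients
begin

text \<open>Squaring \<i> = \<tau> \<beta>^2 gives -1 = -\<tau>^2.\<close>

lemma tau_cases: "\<tau> = 1 \<or> \<tau> = -1"
proof -
  have "(-1 :: complex) = \<i>\<^sup>2" by simp
  also have "\<dots> = of_int (\<tau>\<^sup>2) * (\<beta>\<^sup>2 * \<beta>\<^sup>2)"
    by (subst i_eq) (simp add: power_mult_distrib flip: power_add)
  also have "\<beta>\<^sup>2 * \<beta>\<^sup>2 = -1" using \<beta>4 by (simp flip: power_add)
  finally have "of_int (\<tau>\<^sup>2) = (1 :: complex)" by simp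
  then have "\<tau>\<^sup>2 = 1" by (simp only: of_int_eq_1_iff)
  then show ?thesis by (simp add: power2_eq_1_iff)
qed

lemma checks: "inverse_check \<tau>" "coassociator_check \<tau>" "hexagon_check \<tau>" "mono_check \<tau> m"
proof -
  show "inverse_check \<tau>" "coassociator_check \<tau>" "hexagon_check \<tau>"
    using tau_cases inverse_checks coassociator_checks hexagon_checks by metis+
  have "list_all (mono_check \<tau>) all_monos"
    using tau_cases mono_checks_1 mono_checks_minus_1 by metis
  then show "mono_check \<tau> m" using mono_in_all_monos[of m] unfolding list_all_iff by blast
qed

lemma coevaluation_val: "val1 (coevaluation_rep \<tau>) = coevaluation \<beta>"
proof -
  have "(K - Kinv) * e\<^sub>1 = 2 *\<^sub>C (K * e\<^sub>1)"
    using scaleC_add_left[of 1 1 "K * e\<^sub>1"] by (simp add: Kinv_K left_diff_distrib mult.assoc K_idem)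
  then have "casimir * e\<^sub>1 = F * E * e\<^sub>1 - (\<i>/2) *\<^sub>C (K * e\<^sub>1)"
    by (simp add: casimir_def left_diff_distrib)
  then show ?thesis
    by (simp add: coevaluation_rep_def coevaluation_def generator_vals scalar_vals
        left_diff_distrib cvec.scale_right_diff_distrib mult_ac del: comb_val.simps gauss_val)
qed

text \<open>The generators are represented, and the represented elements are closed under
  products.\<close>

lemma word_val: "\<exists>p. abs_Q (Poly_Mapping.single (Word gs) 1) = val1 p"
proof (induction gs)
  case Nil
  have "abs_Q (Poly_Mapping.single (Word []) 1) = val1 1"
    by (simp only: zero_word_def[symmetric] single_one one_Q.abs_eq[symmetric] t2.ev_1)
  then show ?case by blast
next
  case (Cons g gs)
  then obtain p where p: "abs_Q (Poly_Mapping.single (Word gs) 1) = val1 p" by blast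
  have "Poly_Mapping.single (Word (g # gs)) 1 = free_gen g * Poly_Mapping.single (Word gs) 1"
    by (simp add: free_gen_def mult_single)
  then have "abs_Q (Poly_Mapping.single (Word (g # gs)) 1) = abs_Q (free_gen g) * val1 p"
    by (simp add: times_Q.abs_eq flip: p)
  moreover have "\<exists>q. abs_Q (free_gen g) = val1 q"
    by (cases g) (metis generator_vals(1-4) E_def F_def K_def Kinv_def)+
  ultimately show ?case by (metis t2.ev_mult)
qed

text \<open>The monomials span \<^typ>\<open>Q\<close>, since by \<open>word_val\<close> every word in the generators is represented.\<close>

lemma Q_eq_linear:
  assumes "clinear f" "clinear g" "\<And>m. f (mono_val m) = g (mono_val m)"
  shows "f x = g x"
proof -
  have rep: "f (val1 p) = g (val1 p)" for p
  proof (cases p)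
    case (Comb xs)
    show ?thesis unfolding Comb
      by (induction xs) (auto simp: clinear_0[OF assms(1)] clinear_0[OF assms(2)] clinear_add[OF assms(1)]
          clinear_add[OF assms(2)] clinear_scale[OF assms(1)] clinear_scale[OF assms(2)] assms(3))
  qed
  obtain p where x: "x = abs_Q p" by (rule abs_Q_cases)
  show ?thesis unfolding x
  proof (induction p rule: poly_mapping_single_induct)
    case zero
    show ?case by (simp add: clinear_0[OF assms(1)] clinear_0[OF assms(2)] flip: zero_Q.abs_eq)
  next
    case (single w c)
    obtain gs where w: "w = Word gs" by (cases w)
    have "abs_Q (Poly_Mapping.single w c) = c *\<^sub>C abs_Q (Poly_Mapping.single w 1)"
      by (simp add: scaleC_Q.abs_eq scaleC_single scaleC_complex_def)
    moreover have "f (abs_Q (Poly_Mapping.single w 1)) = g (abs_Q (Poly_Mapping.single w 1))"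
      using word_val[of gs] rep unfolding w by metis
    ultimately show ?case by (simp add: clinear_scale[OF assms(1)] clinear_scale[OF assms(2)])
  next
    case (add p q)
    then show ?case by (simp add: clinear_add[OF assms(1)] clinear_add[OF assms(2)] flip: plus_Q.abs_eq)
  qed
qed

lemmas S_val = S_mono[symmetric] mono_rep t2.ev_mult coevaluation_val

lemma counit_vals:
  "tensor_lift (\<lambda>x y. epsilon x *\<^sub>C y) (val2 d) = val1 (counit_left_rep d)"
  "tensor_lift (\<lambda>x y. epsilon y *\<^sub>C x) (val2 d) = val1 (counit_right_rep d)"
  "tensor_lift3 (\<lambda>x y z. epsilon y *\<^sub>C (x \<otimes> z)) (val3 p) = val2 (counit_middle_rep p)"
  unfolding counit_left_rep_def counit_right_rep_def counit_middle_rep_def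
  subgoal by (rule tensor_lift_val[OF t2.representation_axioms])
      (simp_all add: cbilinear_def clinear_iff epsilon_simps scaleC_add_left scaleC_add_right mult.commute
        epsilon_mono del: comb_val.simps)
  subgoal by (rule tensor_lift_val[OF t2.representation_axioms])
      (simp_all add: cbilinear_def clinear_iff epsilon_simps scaleC_add_left scaleC_add_right mult.commute
        epsilon_mono del: comb_val.simps)
  subgoal by (rule tensor_lift3_val[OF t3.representation_axioms])
      (simp_all add: cbilinear_def clinear_iff epsilon_simps scaleC_add_left scaleC_add_right mult.commute
        pure_tensor_linear tensor_vals epsilon_mono del: comb_val.simps)
  done

lemma antipode_vals:
  "tensor_lift (\<lambda>x y. S x * y) (val2 d) = val1 (antipode_ev_rep \<tau> d)"
  "tensor_lift (\<lambda>x y. x * coevaluation \<beta> * S y) (val2 d) = val1 (antipode_coev_rep \<tau> d)"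
  "tensor_lift3 (\<lambda>x y z. S x * y * coevaluation \<beta> * S z) (val3 p) = val1 (zigzag_rep \<tau> p)"
  "tensor_lift3 (\<lambda>x y z. x * coevaluation \<beta> * S y * z) (val3 p) = val1 (zigzag_inverse_rep \<tau> p)"
  unfolding antipode_ev_rep_def antipode_coev_rep_def zigzag_rep_def zigzag_inverse_rep_def
  subgoal by (rule tensor_lift_val[OF t2.representation_axioms])
      (simp_all add: cbilinear_def clinear_iff S_simps distrib_left distrib_right S_val
        del: comb_val.simps S_mono.simps mono_val.simps)
  subgoal by (rule tensor_lift_val[OF t2.representation_axioms])
      (simp_all add: cbilinear_def clinear_iff S_simps distrib_left distrib_right S_val
        del: comb_val.simps S_mono.simps mono_val.simps)
  subgoal by (rule tensor_lift3_val[OF t2.representation_axioms])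
      (simp_all add: cbilinear_def clinear_iff S_simps distrib_left distrib_right S_val
        del: comb_val.simps S_mono.simps mono_val.simps)
  subgoal by (rule tensor_lift3_val[OF t2.representation_axioms])
      (simp_all add: cbilinear_def clinear_iff S_simps distrib_left distrib_right S_val
        del: comb_val.simps S_mono.simps mono_val.simps)
  done

lemma Delta_vals:
  "tensor_assoc ((Delta \<otimes>\<^sub>m id) (val2 d)) = val3 (Delta_id_rep \<tau> d)"
  "tensor_assoc ((Delta \<otimes>\<^sub>m id \<otimes>\<^sub>m id) (val3 p)) = val4 (Delta_id_rep \<tau> p)"
  "(id \<otimes>\<^sub>m Delta) (val2 d) = val3 (map_coeffs (Delta_rep \<tau>) d)"
  "(id \<otimes>\<^sub>m id \<otimes>\<^sub>m Delta) (val3 p) = val4 (map_coeffs (map_coeffs (Delta_rep \<tau>)) p)"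
  "(id \<otimes>\<^sub>m (\<lambda>t. tensor_assoc ((Delta \<otimes>\<^sub>m id) t))) (val3 p) = val4 (map_coeffs (Delta_id_rep \<tau>) p)"
proof -
  show Did: "tensor_assoc ((Delta \<otimes>\<^sub>m id) (val2 d)) = val3 (Delta_id_rep \<tau> d)" for d
    by (rule Delta_id_val[OF t2.tensor_step_axioms clinear_id]) simp
  show "tensor_assoc ((Delta \<otimes>\<^sub>m id \<otimes>\<^sub>m id) (val3 p)) = val4 (Delta_id_rep \<tau> p)"
    by (rule Delta_id_val[OF t3.tensor_step_axioms clinear_tensor_map[OF clinear_id clinear_id] id_tensor_id])
  show idD: "(id \<otimes>\<^sub>m Delta) (val2 d) = val3 (map_coeffs (Delta_rep \<tau>) d)" for d
    by (rule id_tensor_val, rule clinear_Delta, rule Delta_val)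
  show "(id \<otimes>\<^sub>m id \<otimes>\<^sub>m Delta) (val3 p) = val4 (map_coeffs (map_coeffs (Delta_rep \<tau>)) p)"
    by (rule id_tensor_val, rule clinear_tensor_map[OF clinear_id clinear_Delta], rule idD)
  show "(id \<otimes>\<^sub>m (\<lambda>t. tensor_assoc ((Delta \<otimes>\<^sub>m id) t))) (val3 p) = val4 (map_coeffs (Delta_id_rep \<tau>) p)"
    by (rule id_tensor_val, rule clinear_comp[OF clinear_tensor_assoc clinear_tensor_map[OF clinear_Delta clinear_id]], rule Did)
qed

section \<open>Transfer of the finite calculations to the axioms\<close>

abbreviation "\<Phi> \<equiv> Phi \<beta>"
abbreviation "\<R> \<equiv> R_matrix \<beta>"
abbreviation "\<Psi> \<equiv> val3 (Phi_inv_rep \<tau>)"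

lemma Phi_inverse: "\<Phi> * \<Psi> = 1" "\<Psi> * \<Phi> = 1"
  and leg_231_inverse: "leg_231 \<Phi> * leg_231 \<Psi> = 1" "leg_231 \<Psi> * leg_231 \<Phi> = 1"
  and leg_312_inverse: "leg_312 \<Phi> * leg_312 \<Psi> = 1"
  and leg_213_inverse: "leg_213 \<Phi> * leg_213 \<Psi> = 1" "leg_213 \<Psi> * leg_213 \<Phi> = 1"
  using checks(1) unfolding inverse_check_def
  by (auto dest!: t4.ev_eqI simp: Phi_val leg_vals3[symmetric] simp del: comb_val.simps)

lemma R_inverse: "\<exists>y. \<R> * y = 1 \<and> y * \<R> = 1"
proof -
  have "(2 *\<^sub>C \<R>) * val2 (R_matrix_inv_rep \<tau>) = 4 *\<^sub>C 1" "val2 (R_matrix_inv_rep \<tau>) * (2 *\<^sub>C \<R>) = 4 *\<^sub>C 1"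
    using checks(1) unfolding inverse_check_def
    by (auto dest!: t3.ev_eqI simp: R_matrix_val scalar_vals simp del: comb_val.simps gauss_val)
  then have "(1/4) *\<^sub>C ((2 *\<^sub>C \<R>) * val2 (R_matrix_inv_rep \<tau>)) = 1" "(1/4) *\<^sub>C (val2 (R_matrix_inv_rep \<tau>) * (2 *\<^sub>C \<R>)) = 1"
    by simp_all
  then have "\<R> * ((1/2) *\<^sub>C val2 (R_matrix_inv_rep \<tau>)) = 1" "((1/2) *\<^sub>C val2 (R_matrix_inv_rep \<tau>)) * \<R> = 1"
    by simp_all
  then show ?thesis by blast
qed

lemma scaleC_cancel: "c *\<^sub>C x = c *\<^sub>C y \<Longrightarrow> c \<noteq> 0 \<Longrightarrow> x = y"
  by (metis cvec.scale_left_imp_eq cvec.scale_cancel_left)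

text \<open>These are the axioms that are linear in an element of \<open>Q\<close>, on a single
  monomial; \<open>Q_eq_linear\<close> later extends them to all elements.\<close>

lemma mono_checkD:
  fixes m
  defines "d \<equiv> Delta (mono_val m)"
  shows "tensor_lift (\<lambda>x y. epsilon x *\<^sub>C y) d = mono_val m"
    and "tensor_lift (\<lambda>x y. epsilon y *\<^sub>C x) d = mono_val m"
    and "tensor_lift (\<lambda>x y. S x * y) d = epsilon (mono_val m) *\<^sub>C 1"
    and "tensor_lift (\<lambda>x y. x * coevaluation \<beta> * S y) d = epsilon (mono_val m) *\<^sub>C coevaluation \<beta>"
    and "tensor_assoc ((Delta \<otimes>\<^sub>m id) d) * \<Phi> = \<Phi> * (id \<otimes>\<^sub>m Delta) d"
    and "\<R> * d = leg_21 d * \<R>"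
proof -
  let ?d = "Delta_mono \<tau> m"
  have d: "d = val2 ?d" by (simp only: d_def Delta_mono)
  have c: "vanishes (counit_left_rep ?d - mono_rep m)" "vanishes (counit_right_rep ?d - mono_rep m)"
    "vanishes (antipode_ev_rep \<tau> ?d - (if epsilon_mono m then 1 else 0))"
    "vanishes (antipode_coev_rep \<tau> ?d - (if epsilon_mono m then coevaluation_rep \<tau> else 0))"
    "vanishes (Delta_id_rep \<tau> ?d * Phi_rep \<tau> - Phi_rep \<tau> * map_coeffs (Delta_rep \<tau>) ?d)"
    "vanishes (R_matrix_rep \<tau> * ?d - leg_21_rep ?d * R_matrix_rep \<tau>)"
    using checks(4)[of m] unfolding mono_check.simps coproduct_check_def by blast+
  show "tensor_lift (\<lambda>x y. epsilon x *\<^sub>C y) d = mono_val m" "tensor_lift (\<lambda>x y. epsilon y *\<^sub>C x) d = mono_val m"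
    using c(1,2)[THEN t2.ev_eqI] by (simp_all only: d counit_vals mono_rep)
  show "tensor_lift (\<lambda>x y. S x * y) d = epsilon (mono_val m) *\<^sub>C 1"
    using c(3)[THEN t2.ev_eqI] by (simp add: d antipode_vals epsilon_mono del: comb_val.simps mono_val.simps)
  show "tensor_lift (\<lambda>x y. x * coevaluation \<beta> * S y) d = epsilon (mono_val m) *\<^sub>C coevaluation \<beta>"
    using c(4)[THEN t2.ev_eqI]
    by (simp add: d antipode_vals epsilon_mono coevaluation_val split: if_splits del: comb_val.simps mono_val.simps)
  show "tensor_assoc ((Delta \<otimes>\<^sub>m id) d) * \<Phi> = \<Phi> * (id \<otimes>\<^sub>m Delta) d"
    using c(5)[THEN t4.ev_eqI] by (simp only: d Delta_vals t4.ev_mult Phi_val)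
  have "2 *\<^sub>C (\<R> * d) = 2 *\<^sub>C (leg_21 d * \<R>)"
    using c(6)[THEN t3.ev_eqI]
    by (simp only: d leg_vals t3.ev_mult R_matrix_val mult_scaleC_left mult_scaleC_right)
  then show "\<R> * d = leg_21 d * \<R>" by (rule scaleC_cancel) simp
qed

lemma clinear_mult: "clinear f \<Longrightarrow> clinear (\<lambda>x. a * f x)" "clinear f \<Longrightarrow> clinear (\<lambda>x. f x * a)"
  by (simp_all add: clinear_iff distrib_left distrib_right)

lemma clinear_leg_21: "clinear leg_21"
  unfolding leg_21_def by (intro clinear_tensor_lift) (simp add: cbilinear_def clinear_iff pure_tensor_linear)

lemma counit_axioms:
  "tensor_lift (\<lambda>x y. epsilon x *\<^sub>C y) (Delta a) = a" "tensor_lift (\<lambda>x y. epsilon y *\<^sub>C x) (Delta a) = a"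
proof -
  have "cbilinear (\<lambda>x y. epsilon x *\<^sub>C y :: Q)" "cbilinear (\<lambda>x y. epsilon y *\<^sub>C x :: Q)"
    by (simp_all add: cbilinear_def clinear_iff epsilon_simps scaleC_add_left scaleC_add_right mult.commute)
  note lin = this[THEN clinear_tensor_lift, THEN clinear_comp, OF clinear_Delta]
  have ident: "clinear (\<lambda>x :: Q. x)" by (simp add: clinear_iff)
  show "tensor_lift (\<lambda>x y. epsilon x *\<^sub>C y) (Delta a) = a"
    by (rule Q_eq_linear[OF lin(1) ident]) (simp only: mono_checkD)
  show "tensor_lift (\<lambda>x y. epsilon y *\<^sub>C x) (Delta a) = a"
    by (rule Q_eq_linear[OF lin(2) ident]) (simp only: mono_checkD)
qed

lemma antipode_axioms:
  "tensor_lift (\<lambda>x y. S x * y) (Delta a) = epsilon a *\<^sub>C 1"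
  "tensor_lift (\<lambda>x y. x * coevaluation \<beta> * S y) (Delta a) = epsilon a *\<^sub>C coevaluation \<beta>"
proof -
  have "cbilinear (\<lambda>x y. S x * y)" "cbilinear (\<lambda>x y. x * coevaluation \<beta> * S y)"
    by (simp_all add: cbilinear_def clinear_iff S_simps distrib_left distrib_right)
  note lin = this[THEN clinear_tensor_lift, THEN clinear_comp, OF clinear_Delta]
  have eps: "clinear (\<lambda>a. epsilon a *\<^sub>C x)" for x :: Q
    by (simp add: clinear_iff epsilon_simps scaleC_add_left)
  show "tensor_lift (\<lambda>x y. S x * y) (Delta a) = epsilon a *\<^sub>C 1"
    by (rule Q_eq_linear[OF lin(1) eps]) (simp only: mono_checkD)
  show "tensor_lift (\<lambda>x y. x * coevaluation \<beta> * S y) (Delta a) = epsilon a *\<^sub>C coevaluation \<beta>"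
    by (rule Q_eq_linear[OF lin(2) eps]) (simp only: mono_checkD)
qed

lemma coassociativity: "tensor_assoc ((Delta \<otimes>\<^sub>m id) (Delta a)) * \<Phi> = \<Phi> * (id \<otimes>\<^sub>m Delta) (Delta a)"
proof (rule Q_eq_linear)
  show "clinear (\<lambda>a. tensor_assoc ((Delta \<otimes>\<^sub>m id) (Delta a)) * \<Phi>)"
    by (rule clinear_mult clinear_comp[OF clinear_tensor_assoc] clinear_comp[OF clinear_tensor_map]
        clinear_Delta clinear_id)+
  show "clinear (\<lambda>a. \<Phi> * (id \<otimes>\<^sub>m Delta) (Delta a))"
    by (rule clinear_mult clinear_comp[OF clinear_tensor_map] clinear_Delta clinear_id)+
qed (simp only: mono_checkD)

lemma R_intertwines: "\<R> * Delta a = leg_21 (Delta a) * \<R>"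
proof (rule Q_eq_linear)
  show "clinear (\<lambda>a. \<R> * Delta a)" by (rule clinear_mult clinear_Delta)+
  show "clinear (\<lambda>a. leg_21 (Delta a) * \<R>)" by (rule clinear_mult clinear_comp[OF clinear_leg_21] clinear_Delta)+
qed (simp only: mono_checkD)

lemma coassociator_axioms:
  "tensor_lift3 (\<lambda>x y z. epsilon y *\<^sub>C (x \<otimes> z)) \<Phi> = 1"
  "tensor_lift3 (\<lambda>x y z. S x * y * coevaluation \<beta> * S z) \<Phi> = 1"
  "tensor_lift3 (\<lambda>x y z. x * coevaluation \<beta> * S y * z) \<Psi> = 1"
  "tensor_assoc ((Delta \<otimes>\<^sub>m id \<otimes>\<^sub>m id) \<Phi>) * (id \<otimes>\<^sub>m id \<otimes>\<^sub>m Delta) \<Phi>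
    = in_123 \<Phi> * (id \<otimes>\<^sub>m (\<lambda>t. tensor_assoc ((Delta \<otimes>\<^sub>m id) t))) \<Phi> * in_234 \<Phi>"
proof -
  have c: "vanishes (counit_middle_rep (Phi_rep \<tau>) - 1)"
    "vanishes (zigzag_rep \<tau> (Phi_rep \<tau>) - 1)" "vanishes (zigzag_inverse_rep \<tau> (Phi_inv_rep \<tau>) - 1)"
    "vanishes (Delta_id_rep \<tau> (Phi_rep \<tau>) * map_coeffs (map_coeffs (Delta_rep \<tau>)) (Phi_rep \<tau>)
      - in_123_rep (Phi_rep \<tau>) * map_coeffs (Delta_id_rep \<tau>) (Phi_rep \<tau>) * (1 \<otimes>\<^sub>r Phi_rep \<tau>))"
    using checks(2) unfolding coassociator_check_def by blast+
  show "tensor_lift3 (\<lambda>x y z. epsilon y *\<^sub>C (x \<otimes> z)) \<Phi> = 1"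
    "tensor_lift3 (\<lambda>x y z. S x * y * coevaluation \<beta> * S z) \<Phi> = 1"
    "tensor_lift3 (\<lambda>x y z. x * coevaluation \<beta> * S y * z) \<Psi> = 1"
    using c(1)[THEN t3.ev_eqI] c(2,3)[THEN t2.ev_eqI]
    by (simp_all only: counit_vals antipode_vals t3.ev_1 t2.ev_1 flip: Phi_val)
  show "tensor_assoc ((Delta \<otimes>\<^sub>m id \<otimes>\<^sub>m id) \<Phi>) * (id \<otimes>\<^sub>m id \<otimes>\<^sub>m Delta) \<Phi>
    = in_123 \<Phi> * (id \<otimes>\<^sub>m (\<lambda>t. tensor_assoc ((Delta \<otimes>\<^sub>m id) t))) \<Phi> * in_234 \<Phi>"
    using c(4)[THEN r4.ev_eqI] by (simp only: Delta_vals leg_vals3 in_vals r4.ev_mult flip: Phi_val)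
qed

lemma hexagon_axioms:
  "tensor_assoc ((Delta \<otimes>\<^sub>m id) \<R>) = leg_231 \<Psi> * in_13 \<R> * leg_132 \<Phi> * in_23 \<R> * \<Psi>"
  "(id \<otimes>\<^sub>m Delta) \<R> = leg_312 \<Phi> * in_13 \<R> * leg_213 \<Psi> * in_12 \<R> * \<Phi>"
proof -
  have scale: "in_12 (2 *\<^sub>C \<R>) = 2 *\<^sub>C in_12 \<R>" "in_13 (2 *\<^sub>C \<R>) = 2 *\<^sub>C in_13 \<R>"
    "in_23 (2 *\<^sub>C \<R>) = 2 *\<^sub>C in_23 \<R>"
    "tensor_assoc ((Delta \<otimes>\<^sub>m id) (2 *\<^sub>C \<R>)) = 2 *\<^sub>C tensor_assoc ((Delta \<otimes>\<^sub>m id) \<R>)"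
    "(id \<otimes>\<^sub>m Delta) (2 *\<^sub>C \<R>) = 2 *\<^sub>C (id \<otimes>\<^sub>m Delta) \<R>"
    unfolding in_12_def in_13_def in_23_def
    by (rule clinear_scale, (rule clinear_tensor_lift clinear_comp[OF clinear_tensor_assoc] clinear_tensor_map
          clinear_Delta clinear_id | simp add: cbilinear_def clinear_iff pure_tensor_linear)+)+
  have c: "vanishes (gauss \<tau> 2 0 \<bullet> (leg_231_rep (Phi_rep \<tau>) * Delta_id_rep \<tau> (R_matrix_rep \<tau>) * Phi_rep \<tau>)
      - in_13_rep (R_matrix_rep \<tau>) * leg_132_rep (Phi_rep \<tau>) * (1 \<otimes>\<^sub>r R_matrix_rep \<tau>))"
    "vanishes (gauss \<tau> 2 0 \<bullet> (leg_312_rep (Phi_inv_rep \<tau>) * map_coeffs (Delta_rep \<tau>) (R_matrix_rep \<tau>) * Phi_inv_rep \<tau>)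
      - in_13_rep (R_matrix_rep \<tau>) * leg_213_rep (Phi_inv_rep \<tau>) * in_12_rep (R_matrix_rep \<tau>))"
    using checks(3) unfolding hexagon_check_def by blast+
  \<comment> \<open>On the left one factor 2 comes from \<open>hexagon_check\<close> and one from
    the representative of \<open>2 R\<close>; on the right each of the two R-matrices contributes
    one.\<close>
  have "2 *\<^sub>C 2 *\<^sub>C (leg_231 \<Phi> * tensor_assoc ((Delta \<otimes>\<^sub>m id) \<R>) * \<Phi>)
      = 2 *\<^sub>C 2 *\<^sub>C (in_13 \<R> * leg_132 \<Phi> * in_23 \<R>)"
    using c(1)[THEN t4.ev_eqI]
    by (simp only: t4.ev_mult t4.ev_scl scalar_vals leg_vals[symmetric] leg_vals3[symmetric] in_vals[symmetric]
        Delta_vals[symmetric] R_matrix_val Phi_val scale mult_scaleC_left mult_scaleC_right)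
  then have "leg_231 \<Phi> * tensor_assoc ((Delta \<otimes>\<^sub>m id) \<R>) * \<Phi> = in_13 \<R> * leg_132 \<Phi> * in_23 \<R>"
    by (rule scaleC_cancel[OF scaleC_cancel]) simp_all
  then have "leg_231 \<Psi> * (leg_231 \<Phi> * tensor_assoc ((Delta \<otimes>\<^sub>m id) \<R>) * \<Phi>) * \<Psi>
      = leg_231 \<Psi> * in_13 \<R> * leg_132 \<Phi> * in_23 \<R> * \<Psi>"
    by (simp only: mult.assoc)
  moreover have "leg_231 \<Psi> * (leg_231 \<Phi> * x * \<Phi>) * \<Psi> = (leg_231 \<Psi> * leg_231 \<Phi>) * x * (\<Phi> * \<Psi>)" for x
    by (simp only: mult.assoc)
  ultimately show "tensor_assoc ((Delta \<otimes>\<^sub>m id) \<R>) = leg_231 \<Psi> * in_13 \<R> * leg_132 \<Phi> * in_23 \<R> * \<Psi>"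
    by (simp only: leg_231_inverse Phi_inverse mult_1_left mult_1_right)
  \<comment> \<open>Here the outer coassociators are moved to the left side as
    \<open>leg_312 \<Psi>\<close> and \<Psi>. They are removed again below with
    \<open>leg_312 \<Phi> * leg_312 \<Psi> = 1\<close> and
    \<open>\<Psi> * \<Phi> = 1\<close>.\<close>
  have "2 *\<^sub>C 2 *\<^sub>C (leg_312 \<Psi> * (id \<otimes>\<^sub>m Delta) \<R> * \<Psi>) = 2 *\<^sub>C 2 *\<^sub>C (in_13 \<R> * leg_213 \<Psi> * in_12 \<R>)"
    using c(2)[THEN t4.ev_eqI]
    by (simp only: t4.ev_mult t4.ev_scl scalar_vals leg_vals[symmetric] leg_vals3[symmetric]
        Delta_vals[symmetric] R_matrix_val scale mult_scaleC_left mult_scaleC_right)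
  then have "leg_312 \<Psi> * (id \<otimes>\<^sub>m Delta) \<R> * \<Psi> = in_13 \<R> * leg_213 \<Psi> * in_12 \<R>"
    by (rule scaleC_cancel[OF scaleC_cancel]) simp_all
  then have "leg_312 \<Phi> * (leg_312 \<Psi> * (id \<otimes>\<^sub>m Delta) \<R> * \<Psi>) * \<Phi>
      = leg_312 \<Phi> * in_13 \<R> * leg_213 \<Psi> * in_12 \<R> * \<Phi>"
    by (simp only: mult.assoc)
  moreover have "leg_312 \<Phi> * (leg_312 \<Psi> * x * \<Psi>) * \<Phi> = (leg_312 \<Phi> * leg_312 \<Psi>) * x * (\<Psi> * \<Phi>)" for x
    by (simp only: mult.assoc)
  ultimately show "(id \<otimes>\<^sub>m Delta) \<R> = leg_312 \<Phi> * in_13 \<R> * leg_213 \<Psi> * in_12 \<R> * \<Phi>"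
    by (simp only: leg_312_inverse Phi_inverse mult_1_left mult_1_right)
qed

end

theorem theorem1p2:
  fixes \<beta> :: complex
  assumes "\<beta> ^ 4 = -1"
  shows "quasi_triangular_quasi_hopf_algebra
    Delta epsilon (Phi \<beta>) (R_matrix \<beta>) S evaluation (coevaluation \<beta>)"
proof -
  have "(\<beta>\<^sup>2)\<^sup>2 = \<i>\<^sup>2" using assms by (simp flip: power_mult)
  then have "\<beta>\<^sup>2 = \<i> \<or> \<beta>\<^sup>2 = - \<i>" by (simp only: power2_eq_iff)
  \<comment> \<open>A sign is its own inverse, so it can be moved to the other side; this is the
    \<tau> of the locale.\<close>
  then have "\<i> = of_int 1 * \<beta>\<^sup>2 \<or> \<i> = of_int (-1) * \<beta>\<^sup>2" by auto
  then obtain \<tau> :: int where "\<i> = of_int \<tau> * \<beta>\<^sup>2" by blast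
  then interpret Q_coefficients \<beta> \<tau> using assms by unfold_locales
  \<comment> \<open>Two-sided inverses are unique, so the definite descriptions take the computed
    values.\<close>
  have inv: "the_inverse \<Phi> = \<Psi>" "the_inverse (leg_231 \<Phi>) = leg_231 \<Psi>" "the_inverse (leg_213 \<Phi>) = leg_213 \<Psi>"
    by (intro the_inverse_eq Phi_inverse leg_231_inverse leg_213_inverse)+
  show ?thesis
  proof
    show "has_inverse \<Phi>" unfolding has_inverse_def using Phi_inverse by blast
    show "has_inverse \<R>" unfolding has_inverse_def by (rule R_inverse)
    fix a
    show "tensor_assoc ((Delta \<otimes>\<^sub>m id) (Delta a)) = \<Phi> * (id \<otimes>\<^sub>m Delta) (Delta a) * the_inverse \<Phi>"
      unfolding inv coassociativity[symmetric] by (simp only: mult.assoc Phi_inverse mult_1_right)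
    show "tensor_lift (\<lambda>x y. S x * evaluation * y) (Delta a) = epsilon a *\<^sub>C evaluation"
      by (simp add: evaluation_def antipode_axioms)
    show "tensor_lift3 (\<lambda>x y z. S x * evaluation * y * coevaluation \<beta> * S z) \<Phi> = 1"
      "tensor_lift3 (\<lambda>x y z. x * coevaluation \<beta> * S y * evaluation * z) (the_inverse \<Phi>) = 1"
      unfolding inv by (simp_all add: evaluation_def coassociator_axioms del: comb_val.simps)
    show "tensor_lift3 (\<lambda>x y z. epsilon y *\<^sub>C (x \<otimes> z)) \<Phi> = 1 \<otimes> 1"
      by (simp only: coassociator_axioms one_tensor)
  qed (simp_all only: algebra_hom_Delta algebra_hom_epsilon algebra_antihom_S counit_axioms antipode_axioms
      coassociator_axioms R_intertwines inv hexagon_axioms)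
qed

end
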